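(* Let $N\ge 2$ and let $V_1,\dots,V_{N-1}:\mathbb{T}\to\mathbb{R}$ be $C^3$-smooth functions such that, for every $1\le i\le N-1$ and every $x\in\mathbb{T}$, $(V_i'(x))^2+(V_i''(x))^2\neq 0$ and $V_i(x)\ge 1$. Let $H$, $\gamma_0=2N-1$ and $W$ be as defined in the context, where the constants $a_0,\dots,a_{2N-2}\ge1$ in $W$ are fixed and such that $a_{2N-2}$ and all differences $a_k-a_{k+1}$ are sufficiently large in the sense explained in the context. Then there are constants $h_0\ge 1$, $0<\varepsilon<1$ and $C>0$ (depending on $N$, the potentials and the fixed $a_k$, but not on the solution) such that for every solution $(p,q)(t)$ of the rotator system, writing $W_t:=W((p,q)(t))$ and $H_t:=H((p,q)(t))$, if $H_0\ge h_0$ then $$W_t\le W_0-Ct\,W_0^{1/\gamma_0}\qquad\text{for any } 0\le t\le\varepsilon H_0^{\gamma_0-1}$$ and $$H_t\le H_0-\frac{Ct}{H_0^{\gamma_0-2}}\qquad\text{for any } \varepsilon^{-1}H_0^{\gamma_0-\frac52}\le t\le\varepsilon H_0^{\gamma_0-1}.$$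
   Context: $\mathbb{T}$ is the one-dimensional torus (circle). The chain of rotators has phase space $\mathbb{R}^N\times\mathbb{T}^N\ni(p,q)$ and Hamiltonian $$H(p,q)=\sum_{j=1}^N\frac{p_j^2}{2}+\sum_{j=1}^{N-1}V_j(q_j-q_{j+1}).$$ The equations of motion (the rotator system), with friction on the first rotator, are $$\dot q_j=p_j,\qquad \dot p_j=-\delta_{j1}p_1+V_{j-1}'(q_{j-1}-q_j)-V_j'(q_j-q_{j+1}),\qquad 1\le j\le N,$$ where $V_0=V_N:=0$ and $\delta_{j1}$ is the Kronecker symbol. $F$ denotes the vector field on the right-hand side, and $L_Ff=\operatorname{grad}(f)\cdot F$ is the Lie derivative along $F$. For $1\le j\le N-1$ put $\xi_j(q):=-V_j'(q_j-q_{j+1})$. Set $\gamma_0:=2N-1$, $\alpha_k:=2(N-1)-k$ for $1\le k\le 2(N-1)$, and $$W(p,q)=a_0H^{\gamma_0}-\sum_{j=1}^{N-1}\Big(a_{2j-1}H^{\alpha_{2j-1}}p_j\xi_j+a_{2j}H^{\alpha_{2j}}\xi_jL_F\xi_j\Big).$$ "Sufficiently large" constants $a_k$ means: there exist a threshold $A_{2N-2}$ and functions $A_k=A_k(a_{k+1},\dots,a_{2N-2})$, $0\le k\le 2N-3$, depending only on $N$ and the potentials, such that the statement holds whenever $a_{2N-2}\ge A_{2N-2}$ and $a_k-a_{k+1}\ge A_k(a_{k+1},\dots,a_{2N-2})$ for all $0\le k\le 2N-3$. *)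

theory Defs
  imports "HOL-Analysis.Analysis"
begin

text \<open>
  Rotators are indexed by \<open>{1..N}\<close> and potentials by \<open>{1..N-1}\<close>; values at other indices are never
  constrained or used. A function on the circle \<open>\<real>/L\<int>\<close> is represented by its \<open>L\<close>-periodic lift to the
  reals, and a curve of angles by a continuous lift. The vector field and all observables below depend
  on the angles only through \<open>L\<close>-periodic functions of their differences, so nothing depends on the
  chosen lifts.
\<close>

type_synonym state = "(nat \<Rightarrow> real) \<times> (nat \<Rightarrow> real)"  \<comment> \<open>\<open>(p, q)\<close>\<close>

definition Ck_smooth :: "nat \<Rightarrow> (real \<Rightarrow> real) \<Rightarrow> bool" where
  "Ck_smooth k f \<longleftrightarrow>
     (\<forall>i<k. (deriv ^^ i) f differentiable_on UNIV) \<and> continuous_on UNIV ((deriv ^^ k) f)"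

definition circle_Ck :: "real \<Rightarrow> nat \<Rightarrow> (real \<Rightarrow> real) \<Rightarrow> bool" where
  "circle_Ck L k f \<longleftrightarrow> (\<forall>x. f (x + L) = f x) \<and> Ck_smooth k f"

definition hamiltonian :: "nat \<Rightarrow> (nat \<Rightarrow> real \<Rightarrow> real) \<Rightarrow> state \<Rightarrow> real" where
  "hamiltonian N V = (\<lambda>(p, q).
     (\<Sum>j=1..N. (p j)\<^sup>2 / 2) + (\<Sum>j=1..N-1. V j (q j - q (j + 1))))"

text \<open>The convention \<open>V\<^sub>0 = V\<^sub>N = 0\<close>.\<close>

definition ext_pot :: "nat \<Rightarrow> (nat \<Rightarrow> real \<Rightarrow> real) \<Rightarrow> nat \<Rightarrow> real \<Rightarrow> real" where
  "ext_pot N V j = (if 1 \<le> j \<and> j \<le> N - 1 then V j else (\<lambda>_. 0))"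

definition rotator_field :: "nat \<Rightarrow> (nat \<Rightarrow> real \<Rightarrow> real) \<Rightarrow> state \<Rightarrow> state" where
  "rotator_field N V = (\<lambda>(p, q).
     (\<lambda>j. - (if j = 1 then p 1 else 0)
           + deriv (ext_pot N V (j - 1)) (q (j - 1) - q j)
           - deriv (ext_pot N V j) (q j - q (j + 1)),
      p))"

definition rotator_solution :: "nat \<Rightarrow> (nat \<Rightarrow> real \<Rightarrow> real) \<Rightarrow> (real \<Rightarrow> state) \<Rightarrow> bool" where
  "rotator_solution N V z \<longleftrightarrow> (\<forall>t\<ge>0. \<forall>j\<in>{1..N}.
     ((\<lambda>s. fst (z s) j) has_real_derivative fst (rotator_field N V (z t)) j) (at t within {0..}) \<and>
     ((\<lambda>s. snd (z s) j) has_real_derivative snd (rotator_field N V (z t)) j) (at t within {0..}))"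

definition lie_deriv :: "nat \<Rightarrow> (state \<Rightarrow> state) \<Rightarrow> (state \<Rightarrow> real) \<Rightarrow> state \<Rightarrow> real" where
  "lie_deriv N F f = (\<lambda>(p, q).
     (\<Sum>i=1..N. deriv (\<lambda>s. f (p(i := s), q)) (p i) * fst (F (p, q)) i)
   + (\<Sum>i=1..N. deriv (\<lambda>s. f (p, q(i := s))) (q i) * snd (F (p, q)) i))"

definition xi :: "(nat \<Rightarrow> real \<Rightarrow> real) \<Rightarrow> nat \<Rightarrow> state \<Rightarrow> real" where
  "xi V j = (\<lambda>(p, q). - deriv (V j) (q j - q (j + 1)))"

definition gamma0 :: "nat \<Rightarrow> nat" where
  "gamma0 N = 2 * N - 1"

definition alpha :: "nat \<Rightarrow> nat \<Rightarrow> nat" where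
  "alpha N k = 2 * (N - 1) - k"

definition lyapunov :: "nat \<Rightarrow> (nat \<Rightarrow> real \<Rightarrow> real) \<Rightarrow> (nat \<Rightarrow> real) \<Rightarrow> state \<Rightarrow> real" where
  "lyapunov N V a x =
     a 0 * hamiltonian N V x ^ gamma0 N
     - (\<Sum>j=1..N-1.
          a (2*j - 1) * hamiltonian N V x ^ alpha N (2*j - 1) * fst x j * xi V j x
        + a (2*j) * hamiltonian N V x ^ alpha N (2*j) * xi V j x
            * lie_deriv N (rotator_field N V) (xi V j) x)"

text \<open>
  The threshold \<open>A\<^sub>k\<close> receives the list \<open>[a\<^sub>k\<^sub>+\<^sub>1, \<dots>, a\<^sub>2\<^sub>N\<^sub>-\<^sub>2]\<close>; for \<open>k = 2N-2\<close> this list is empty, so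
  that \<open>A\<^sub>2\<^sub>N\<^sub>-\<^sub>2\<close> is a constant.
\<close>

definition sufficiently_large :: "nat \<Rightarrow> (nat \<Rightarrow> real list \<Rightarrow> real) \<Rightarrow> (nat \<Rightarrow> real) \<Rightarrow> bool" where
  "sufficiently_large N A a \<longleftrightarrow>
     a (2*N - 2) \<ge> A (2*N - 2) [] \<and>
     (\<forall>k\<le>2*N - 3. a k - a (k + 1) \<ge> A k (map a [k+1..<2*N - 1]))"

end

theory Submission
  imports Defs
begin

text \<open>
  Along a solution the energy satisfies \<open>H' = - p\<^sub>1\<^sup>2\<close>, which dissipates only the first momentum. The
  corrections in \<open>W\<close> pass this dissipation down the chain. With \<open>r = sqrt H\<close>, put \<open>Y\<^sub>0 = p\<^sub>1 r\<^bsup>2N-2\<^esup>\<close>,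
  \<open>Y\<^sub>2\<^sub>j\<^sub>-\<^sub>1 = \<xi>\<^sub>j r\<^bsup>2N-1-2j\<^esup>\<close> and \<open>Y\<^sub>2\<^sub>j = (L\<^sub>F\<xi>\<^sub>j) r\<^bsup>2N-2-2j\<^esup>\<close>. The term of \<open>W\<close> with coefficient \<open>a\<^sub>m\<close>
  contributes \<open>a\<^sub>m Y\<^sub>m\<^sup>2\<close> to \<open>-W'\<close>, and every other contribution of it is bounded, by the inequality of
  the means, by a quarter of \<open>a\<^sub>m Y\<^sub>m\<^sup>2 + a\<^sub>m\<^sub>+\<^sub>1 Y\<^sub>m\<^sub>+\<^sub>1\<^sup>2\<close> plus \<open>K a\<^sub>m\<^sup>2 (Y\<^sub>0\<^sup>2 + \<dots> + Y\<^sub>m\<^sub>-\<^sub>1\<^sup>2)\<close>. If each \<open>a\<^sub>k\<close>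
  dominates \<open>4K\<close> times the sum of the later squares \<open>a\<^sub>m\<^sup>2\<close>, everything is absorbed and \<open>-W'\<close> is at
  least a quarter of \<open>\<Sum> Y\<^sub>m\<^sup>2\<close>. Nondegeneracy of the potentials lets \<open>Y\<^sub>2\<^sub>j\<^sub>-\<^sub>1\<close> and \<open>Y\<^sub>2\<^sub>j\<close> control
  \<open>p\<^sub>j - p\<^sub>j\<^sub>+\<^sub>1\<close>, so \<open>\<Sum> Y\<^sub>m\<^sup>2\<close> controls all momenta, hence \<open>H\<close> when \<open>H\<close> is large.

  To integrate \<open>W' \<le> - c H\<close>, use that \<open>W\<close> differs from \<open>a\<^sub>0 H\<^bsup>\<gamma>\<^esup>\<close>, \<open>\<gamma> = 2N - 1\<close>, by at most
  \<open>B H\<^bsup>\<gamma>-3/2\<^esup>\<close>. Either \<open>H\<close> stays above half its initial value and the inequality integrates directly,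
  or \<open>W\<close> has already dropped by a fixed fraction of \<open>H\<^sub>0\<^bsup>\<gamma>\<^esup>\<close>, more than is claimed on the time interval.
\<close>

section \<open>Integration of the Lyapunov inequality\<close>

lemma power_diff_le:
  fixes x y :: real
  assumes "0 \<le> y" "y \<le> x"
  shows "x ^ Suc n - y ^ Suc n \<le> real (Suc n) * x ^ n * (x - y)"
proof (induction n)
  case 0 show ?case by simp
next
  case (Suc n)
  have "x ^ Suc (Suc n) - y ^ Suc (Suc n) = x * (x ^ Suc n - y ^ Suc n) + y ^ Suc n * (x - y)"
    by (simp add: algebra_simps)
  also have "\<dots> \<le> x * (real (Suc n) * x ^ n * (x - y)) + x ^ Suc n * (x - y)"
    by (intro add_mono mult_left_mono mult_right_mono Suc.IH power_mono) (use assms in auto)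
  also have "\<dots> = real (Suc (Suc n)) * x ^ Suc n * (x - y)"
    by (simp add: algebra_simps)
  finally show ?case .
qed

text \<open>The mean value theorem. The derivative is taken within a superset \<open>A\<close> of
  the interval because solutions are differentiable within \<open>{0..}\<close>, hence only
  one-sidedly at time 0.\<close>

lemma growth_le_of_deriv_le:
  fixes f :: "real \<Rightarrow> real"
  assumes der: "\<And>u. s \<le> u \<Longrightarrow> u \<le> t \<Longrightarrow> (f has_real_derivative f' u) (at u within A)"
    and A: "{s..t} \<subseteq> A" and le: "\<And>u. s \<le> u \<Longrightarrow> u \<le> t \<Longrightarrow> f' u \<le> m" and st: "s \<le> t"
  shows "f t \<le> f s + m * (t - s)"
proof (cases "s = t")
  case False
  have "(f has_derivative (\<lambda>h. f' u * h)) (at u within {s..t})" if "s \<le> u" "u \<le> t" for u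
    using has_field_derivative_subset[OF der[OF that] A] by (simp add: has_field_derivative_def)
  then obtain u where u: "u \<in> {s<..<t}" "f t - f s = f' u * (t - s)"
    using mvt_simple[of s t f "\<lambda>u h. f' u * h"] False st by auto
  have "f' u * (t - s) \<le> m * (t - s)"
    by (rule mult_right_mono) (use u le[of u] st in auto)
  with u(2) show ?thesis by linarith
qed simp

text \<open>The passage from the differential inequality to decay involves only functions of time.
  The constants are fixed before \<open>H\<close>, \<open>W\<close>, \<open>W'\<close>, so they
  serve all solutions at once. A drop of order \<open>t * H 0\<close> in \<open>W\<close> beats the
  comparison error, of order \<open>n - 3/2\<close> in the energy, once \<open>t\<close> is of order
  \<open>n - 5/2\<close>: this is the waiting time in the second claim.\<close>

lemma decay_from_lyapunov_rate:
  fixes n :: nat and a0 B c h1 :: real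
  assumes n: "n \<ge> 3" and a0: "a0 \<ge> 1" and B: "B \<ge> 1" and c: "c > 0" and h1: "h1 \<ge> 1"
  obtains h0 \<epsilon> C :: real where "h0 \<ge> 1" "0 < \<epsilon>" "\<epsilon> < 1" "C > 0"
    and "\<And>H W W'. \<lbrakk>\<And>t. t \<ge> 0 \<Longrightarrow> H t \<ge> 1; \<And>s t. 0 \<le> s \<Longrightarrow> s \<le> t \<Longrightarrow> H t \<le> H s;
           \<And>t. t \<ge> 0 \<Longrightarrow> \<bar>W t - a0 * H t ^ n\<bar> \<le> B * (H t ^ (n - 2) * sqrt (H t));
           \<And>t. t \<ge> 0 \<Longrightarrow> (W has_real_derivative W' t) (at t within {0..});
           \<And>t. t \<ge> 0 \<Longrightarrow> H t \<ge> h1 \<Longrightarrow> W' t \<le> - c * H t; H 0 \<ge> h0\<rbrakk> \<Longrightarrow>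
         (\<forall>t. 0 \<le> t \<and> t \<le> \<epsilon> * H 0 ^ (n - 1) \<longrightarrow> W t \<le> W 0 - C * t * W 0 powr (1 / real n)) \<and>
         (\<forall>t. inverse \<epsilon> * H 0 powr (real n - 5/2) \<le> t \<and> t \<le> \<epsilon> * H 0 ^ (n - 1) \<longrightarrow>
              H t \<le> H 0 - C * t / H 0 ^ (n - 2))"
proof -
  \<comment> \<open>In \<open>c1\<close>, \<open>c / 2\<close> is the rate while the energy stays
    above half its initial value, and \<open>1 / 4\<close> matches the relative drop of
    \<open>W\<close> otherwise. In \<open>h0\<close>, \<open>2 * h1\<close> keeps half the initial
    energy above the threshold of the rate, and \<open>8 * B\<close> makes the comparison error at
    most an eighth of the leading power.\<close>
  define c1 where "c1 = min (c / 2) (1 / 4)"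
  define h0 where "h0 = max (2 * h1) (8 * B)"
  \<comment> \<open>With this \<open>\<epsilon>\<close> the lower bound on \<open>t\<close> fits two
    comparison errors into half of the drop \<open>c1 * t * x\<close>. In \<open>C\<close>, the
    factor \<open>2 * a0\<close> pays for the bound on the root of \<open>W 0\<close> in the first
    claim; in the second, the whole denominator comes from \<open>power_diff_le\<close>.\<close>
  define \<epsilon> where "\<epsilon> = c1 / (4 * B)"
  define C where "C = c1 / (2 * a0 * n)"
  have c1: "0 < c1" "c1 \<le> c / 2" "c1 \<le> 1 / 4" using c by (auto simp: c1_def)
  have h0: "h0 \<ge> 2 * h1" "h0 \<ge> 8 * B" "h0 \<ge> 1" using h1 by (auto simp: h0_def)
  have \<epsilon>: "0 < \<epsilon>" "\<epsilon> < 1" using c1 B by (auto simp: \<epsilon>_def field_simps)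
  have C: "C > 0" using c1 a0 n by (simp add: C_def)
  show thesis
  proof (rule that[OF h0(3) \<epsilon> C])
    fix H W W' :: "real \<Rightarrow> real"
    assume H1: "\<And>t. t \<ge> 0 \<Longrightarrow> H t \<ge> 1"
      and anti: "\<And>s t. 0 \<le> s \<Longrightarrow> s \<le> t \<Longrightarrow> H t \<le> H s"
      and close: "\<And>t. t \<ge> 0 \<Longrightarrow> \<bar>W t - a0 * H t ^ n\<bar> \<le> B * (H t ^ (n - 2) * sqrt (H t))"
      and der: "\<And>t. t \<ge> 0 \<Longrightarrow> (W has_real_derivative W' t) (at t within {0..})"
      and rate: "\<And>t. t \<ge> 0 \<Longrightarrow> H t \<ge> h1 \<Longrightarrow> W' t \<le> - c * H t"
      and start: "H 0 \<ge> h0"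
    define x where "x = H 0"
    have x: "x \<ge> 1" "x \<ge> 8 * B" "x \<ge> 2 * h1" using start h0 by (auto simp: x_def)
    have xn1: "x ^ n = x ^ (n - 1) * x"
      using n by (cases n) simp_all
    have xn2: "x ^ (n - 1) = x ^ (n - 2) * x"
      using n by (cases "n - 1") (simp_all add: numeral_2_eq_2 diff_Suc split: nat.splits)
    have low: "B * (x ^ (n - 2) * sqrt x) \<le> x ^ n / 8"
    proof -
      have "sqrt x \<le> x" using x by (simp add: real_le_lsqrt power2_eq_square)
      then have "B * (x ^ (n - 2) * sqrt x) \<le> (x / 8) * (x ^ (n - 2) * x)"
        by (intro mult_mono) (use x B in auto)
      also have "\<dots> = x ^ n / 8" unfolding xn1 xn2 by simp
      finally show ?thesis .
    qed
    have err: "B * (H t ^ (n - 2) * sqrt (H t)) \<le> B * (x ^ (n - 2) * sqrt x)" if "t \<ge> 0" for t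
      using H1[OF that] anti[of 0 t] that B x
      by (intro mult_left_mono mult_mono power_mono) (auto simp: x_def)
    have xn: "1 \<le> x ^ n" using x by simp
    have xa: "x ^ n \<le> a0 * x ^ n" using a0 xn by simp
    have W0: "\<bar>W 0 - a0 * x ^ n\<bar> \<le> a0 * x ^ n / 8"
      using close[of 0] low xa by (simp add: x_def)
    have core: "W t \<le> W 0 - c1 * t * x" if t: "0 \<le> t" "t \<le> \<epsilon> * x ^ (n - 1)" for t
    proof (cases "H t \<ge> x / 2")
      case True
      have "W' s \<le> - c1 * x" if "0 \<le> s" "s \<le> t" for s
      proof -
        have Hs: "H s \<ge> x / 2" using True anti[of s t] that by simp
        then have "W' s \<le> - c * H s" using rate[of s] x that by auto
        also have "c * (x / 2) \<le> c * H s" using Hs c by simp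
        moreover have "c1 * x \<le> c / 2 * x" using c1 x by (intro mult_right_mono) auto
        ultimately show ?thesis by simp
      qed
      from growth_le_of_deriv_le[OF der _ this t(1)] show ?thesis by (simp add: mult_ac)
    next
      case False
      \<comment> \<open>Now \<open>W t\<close> is at most 5/8 and \<open>W 0\<close> at least 7/8 of
        \<open>a0 * x ^ n\<close>. The drop of at least a quarter covers \<open>c1 * t * x\<close>,
        since \<open>t\<close> is at most \<open>x ^ (n - 1)\<close>.\<close>
      have "H t ^ n \<le> (x / 2) ^ n" using False H1[OF t(1)] by (intro power_mono) auto
      also have "\<dots> = x ^ n / 2 ^ n" by (simp add: power_divide)
      also have "\<dots> \<le> x ^ n / 2 ^ 1"
        by (intro divide_left_mono power_increasing) (use n xn in auto)
      finally have "a0 * H t ^ n \<le> a0 * (x ^ n / 2)" using a0 by (intro mult_left_mono) auto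
      then have Wt: "W t \<le> a0 * x ^ n / 2 + a0 * x ^ n / 8"
        using close[OF t(1)] err[OF t(1)] low xa by simp
      have "c1 * t * x \<le> (1 / 4) * (1 * x ^ (n - 1)) * x"
      proof (intro mult_mono)
        have "\<epsilon> * x ^ (n - 1) \<le> 1 * x ^ (n - 1)" using \<epsilon> x by (intro mult_right_mono) auto
        then show "t \<le> 1 * x ^ (n - 1)" using t by simp
      qed (use c1 x t in auto)
      also have "\<dots> \<le> a0 * x ^ n / 4" using xa by (simp add: xn1)
      finally show ?thesis using Wt W0 by linarith
    qed
    have root: "W 0 powr (1 / real n) \<le> 2 * a0 * x"
    proof -
      have "0 \<le> W 0" using W0 xn xa by linarith
      moreover have "W 0 \<le> 2 * a0 * x ^ n" using W0 xn xa by linarith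
      ultimately have "W 0 powr (1 / real n) \<le> (2 * a0 * x ^ n) powr (1 / real n)"
        by (intro powr_mono2) auto
      also have "\<dots> \<le> ((2 * a0 * x) ^ n) powr (1 / real n)"
      proof (intro powr_mono2)
        have "2 * a0 \<le> (2 * a0) ^ n" using a0 n by (intro self_le_power) auto
        then show "2 * a0 * x ^ n \<le> (2 * a0 * x) ^ n"
          using xn by (simp add: power_mult_distrib)
      qed (use a0 xn in auto)
      also have "\<dots> = 2 * a0 * x"
        using a0 x n by (simp flip: powr_realpow add: powr_powr)
      finally show ?thesis .
    qed
    have first: "W t \<le> W 0 - C * t * W 0 powr (1 / real n)"
      if t: "0 \<le> t" "t \<le> \<epsilon> * x ^ (n - 1)" for t
    proof -
      have "C * t * W 0 powr (1 / real n) \<le> C * t * (2 * a0 * x)"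
        using root C t by (intro mult_left_mono) auto
      also have "\<dots> = c1 * t * x / n" using a0 n by (simp add: C_def field_simps)
      also have "\<dots> \<le> c1 * t * x / 1" using c1 t x n by (intro divide_left_mono) auto
      finally show ?thesis using core[OF t] by simp
    qed
    have second: "H t \<le> x - C * t / x ^ (n - 2)"
      if t: "inverse \<epsilon> * x powr (real n - 5/2) \<le> t" "t \<le> \<epsilon> * x ^ (n - 1)" for t
    proof -
      have t0: "0 \<le> t" using t(1) \<epsilon> by (meson inverse_nonnegative_iff_nonnegative less_imp_le mult_nonneg_nonneg order_trans powr_ge_zero)
      have Ht: "1 \<le> H t" "H t \<le> x" using H1[OF t0] anti[of 0 t] t0 by (auto simp: x_def)
      have "x ^ (n - 2) * sqrt x = x powr (real (n - 2)) * x powr (1/2)"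
        using x by (simp add: powr_realpow powr_half_sqrt)
      also have "\<dots> = x powr (real n - 5/2 + 1)"
        using n by (simp add: of_nat_diff flip: powr_add)
      also have "\<dots> = x powr (real n - 5/2) * x" unfolding powr_add using x by simp
      finally have e1: "x ^ (n - 2) * sqrt x = x powr (real n - 5/2) * x" .
      have "x powr (real n - 5/2) \<le> \<epsilon> * t" using t(1) \<epsilon> by (simp add: field_simps)
      then have "2 * B * (x ^ (n - 2) * sqrt x) \<le> 2 * B * (\<epsilon> * t * x)"
        unfolding e1 using x B by (intro mult_left_mono mult_right_mono) auto
      also have "\<dots> = c1 / 2 * t * x" using B by (simp add: \<epsilon>_def)
      finally have e2: "2 * B * (x ^ (n - 2) * sqrt x) \<le> c1 / 2 * t * x" .
      \<comment> \<open>Passing from \<open>W\<close> to the energy costs one comparison error at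
        time \<open>t\<close> and one at time 0; half of the drop survives.\<close>
      have "a0 * H t ^ n \<le> a0 * x ^ n - c1 / 2 * t * x"
        using close[OF t0] err[OF t0] close[of 0, folded x_def] core[OF t0 t(2)] e2
        by linarith
      then have "c1 / 2 * t * x \<le> a0 * (x ^ n - H t ^ n)" by (simp add: algebra_simps)
      also have "\<dots> \<le> a0 * (real n * x ^ (n - 1) * (x - H t))"
        using power_diff_le[of "H t" x "n - 1"] Ht n a0 by (intro mult_left_mono) auto
      finally have "c1 / 2 * t * x \<le> (a0 * real n * x ^ (n - 2) * (x - H t)) * x"
        unfolding xn2 by (simp only: mult_ac)
      then have "c1 / 2 * t \<le> a0 * real n * x ^ (n - 2) * (x - H t)"
        by (rule mult_right_le_imp_le) (use x in simp)
      then have "C * t / x ^ (n - 2) \<le> x - H t"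
        using a0 n x by (simp add: C_def field_simps)
      then show ?thesis by simp
    qed
    show "(\<forall>t. 0 \<le> t \<and> t \<le> \<epsilon> * H 0 ^ (n - 1) \<longrightarrow> W t \<le> W 0 - C * t * W 0 powr (1 / real n)) \<and>
         (\<forall>t. inverse \<epsilon> * H 0 powr (real n - 5/2) \<le> t \<and> t \<le> \<epsilon> * H 0 ^ (n - 1) \<longrightarrow>
              H t \<le> H 0 - C * t / H 0 ^ (n - 2))"
      using first second unfolding x_def by blast
  qed
qed

section \<open>Absorption of the error terms\<close>

lemma abs_mult_le_weighted:
  fixes x y w :: real
  assumes "w > 0"
  shows "\<bar>x * y\<bar> \<le> w * x\<^sup>2 + y\<^sup>2 / (4 * w)"
proof -
  have "0 \<le> (2 * w * \<bar>x\<bar> - \<bar>y\<bar>)\<^sup>2" by simp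
  then show ?thesis using assms
    by (simp add: field_simps power2_eq_square abs_mult)
qed

text \<open>Young's inequality in the form used for absorption: the square of \<open>x\<close> is
  kept with a prescribed weight, and \<open>y\<close> is a quantity already controlled.\<close>

lemma abs_mult_le_weighted':
  fixes x y w :: real
  assumes "w > 0" "y\<^sup>2 \<le> u"
  shows "\<bar>x * y\<bar> \<le> w * x\<^sup>2 + u / (4 * w)"
  using abs_mult_le_weighted[OF assms(1), of x y] assms
  by (smt (verit) divide_right_mono)

text \<open>Multiply the nondegeneracy bound by the square of \<open>\<Delta>\<close>: the
  \<open>B\<close> part is exactly the square of \<open>e\<close>, and in the \<open>X\<close> part
  \<open>\<Delta>\<close> is replaced by its bound \<open>4 * r\<close>. So a force and its rate
  together control the momentum gap across the bond, at the price of one factor \<open>r\<close> on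
  the force.\<close>

lemma gap_bound:
  fixes r c X B e \<Delta> w :: real
  assumes r: "r \<ge> 1" and \<Delta>: "\<bar>\<Delta>\<bar> \<le> 4 * r" and nondeg: "c \<le> X\<^sup>2 + B\<^sup>2" and e: "e = - B * \<Delta>"
  shows "c * (\<Delta> * w)\<^sup>2 \<le> (e * w)\<^sup>2 + 16 * (X * (r * w))\<^sup>2"
proof -
  have "c * \<Delta>\<^sup>2 \<le> (X\<^sup>2 + B\<^sup>2) * \<Delta>\<^sup>2" using nondeg by (intro mult_right_mono) auto
  also have "\<dots> = X\<^sup>2 * \<Delta>\<^sup>2 + B\<^sup>2 * \<Delta>\<^sup>2" by (simp add: algebra_simps)
  also have "X\<^sup>2 * \<Delta>\<^sup>2 \<le> X\<^sup>2 * (4 * r)\<^sup>2"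
    using \<Delta> r by (intro mult_left_mono abs_le_square_iff[THEN iffD1]) auto
  finally have "c * \<Delta>\<^sup>2 \<le> e\<^sup>2 + 16 * X\<^sup>2 * r\<^sup>2"
    by (simp add: e algebra_simps power_mult_distrib)
  then have "c * \<Delta>\<^sup>2 * w\<^sup>2 \<le> (e\<^sup>2 + 16 * X\<^sup>2 * r\<^sup>2) * w\<^sup>2"
    by (intro mult_right_mono) auto
  then show ?thesis by (simp add: power_mult_distrib algebra_simps)
qed

text \<open>
  In the next two lemmas \<open>r\<close> is the square root of the energy; \<open>p\<close>, \<open>X\<close>, \<open>e\<close> are \<open>p\<^sub>j\<close>, \<open>\<xi>\<^sub>j\<close>,
  \<open>L\<^sub>F\<xi>\<^sub>j\<close> with \<open>j = N - 1 - k\<close>, and \<open>n = 2N - 3\<close>. The force on the preceding (following) bond is \<open>X'\<close>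
  (\<open>X''\<close>), and \<open>d\<close> is the friction term. \<open>U\<close> bounds the squares that come earlier in the hierarchy.
\<close>

lemma odd_term_lower_bound:
  fixes r a b K M U p X X' e d p1 :: real and k n :: nat
  assumes r: "r \<ge> 1" and a: "a \<ge> 1" and b: "b \<ge> 1" and K: "K \<ge> 0" and M: "M \<ge> 0"
    and kn: "2 * k + 1 \<le> n"
    and P: "(p * r ^ (2*k+2))\<^sup>2 \<le> K * U" and S': "(X' * r ^ (2*k+3))\<^sup>2 \<le> U"
    and D: "(d * r ^ (2*k+2))\<^sup>2 \<le> U" and P1: "(p1 * r ^ (n + 1))\<^sup>2 \<le> U"
    and X: "\<bar>X\<bar> \<le> M" and p: "\<bar>p\<bar> \<le> 2 * r"
  shows "a * ((r\<^sup>2) ^ (2*k+1) * ((- d - X' + X) * X + p * e) - real (2*k+1) * (r\<^sup>2) ^ (2*k) * p1\<^sup>2 * p * X)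
    \<ge> a * (X * r ^ (2*k+1))\<^sup>2 - (a * (X * r ^ (2*k+1))\<^sup>2 + b * (e * r ^ (2*k))\<^sup>2) / 4
      - (K + 4 + 2 * M * n) * a\<^sup>2 * U"
proof -
  define S where "S = X * r ^ (2*k+1)"
  define E where "E = e * r ^ (2*k)"
  have r4: "r ^ (4*k) = r ^ (2*k) * r ^ (2*k)" by (simp flip: power_add)
  have U: "U \<ge> 0" using S' by (smt (verit) zero_le_power2)
  have pw: "(r\<^sup>2) ^ (2*k+1) = r ^ (4*k+2)" "(r\<^sup>2) ^ (2*k) = r ^ (4*k)"
    unfolding power_mult[symmetric] by (simp_all add: algebra_simps)
  \<comment> \<open>\<open>E\<close> comes next in the hierarchy, with coefficient \<open>b\<close>.
    The weight \<open>b / (4 * a)\<close> becomes \<open>b / 4\<close> after the final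
    multiplication by \<open>a\<close>.\<close>
  have t1: "\<bar>E * (p * r ^ (2*k+2))\<bar> \<le> b / (4 * a) * E\<^sup>2 + K * U / (4 * (b / (4 * a)))"
    by (rule abs_mult_le_weighted') (use a b P in auto)
  have t1': "K * U / (4 * (b / (4 * a))) \<le> K * a * U"
  proof -
    have "K * U * a / b \<le> K * U * a / 1"
      using K U a b by (intro divide_left_mono) auto
    then show ?thesis by (simp add: mult_ac)
  qed
  \<comment> \<open>Two weights of 1/8, here and in \<open>t3\<close>, spend together a quarter of
    the square of \<open>S\<close>.\<close>
  have t2: "\<bar>S * (X' * r ^ (2*k+3))\<bar> \<le> 1/8 * S\<^sup>2 + U / (4 * (1/8))"
    by (rule abs_mult_le_weighted') (use S' in auto)
  have t3: "\<bar>S * (d * r ^ (2*k+2))\<bar> \<le> 1/8 * S\<^sup>2 + U / (4 * (1/8))"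
    by (rule abs_mult_le_weighted') (use D in auto)
  have e2: "r ^ (4*k+2) * \<bar>X' * X\<bar> \<le> \<bar>S * (X' * r ^ (2*k+3))\<bar>"
  proof -
    have "r ^ (4*k+2) * \<bar>X' * X\<bar> \<le> r ^ (4*k+4) * \<bar>X' * X\<bar>"
      by (intro mult_right_mono power_increasing) (use r in auto)
    also have "\<dots> = \<bar>S * (X' * r ^ (2*k+3))\<bar>"
      using r by (simp add: S_def abs_mult power_add power2_eq_square eval_nat_numeral r4)
    finally show ?thesis .
  qed
  have e3: "r ^ (4*k+2) * \<bar>d * X\<bar> \<le> \<bar>S * (d * r ^ (2*k+2))\<bar>"
  proof -
    have "r ^ (4*k+2) * \<bar>d * X\<bar> \<le> r ^ (4*k+3) * \<bar>d * X\<bar>"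
      by (intro mult_right_mono power_increasing) (use r in auto)
    also have "\<dots> = \<bar>S * (d * r ^ (2*k+2))\<bar>"
      using r by (simp add: S_def abs_mult power_add power2_eq_square eval_nat_numeral r4)
    finally show ?thesis .
  qed
  have e1: "r ^ (4*k+2) * (p * e) = E * (p * r ^ (2*k+2))"
    by (simp add: E_def power_add power2_eq_square r4)
  have e0: "r ^ (4*k+2) * (X * X) = S\<^sup>2"
    by (simp add: S_def power2_eq_square power_add r4)
  \<comment> \<open>This term comes from differentiating the power of the energy, whose rate is
    minus the square of \<open>p1\<close>. The first square of the hierarchy carries a much higher
    power of \<open>r\<close> and dominates it.\<close>
  have e4: "\<bar>real (2*k+1) * r ^ (4*k) * p1\<^sup>2 * p * X\<bar> \<le> 2 * M * n * U"
  proof -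
    have "\<bar>real (2*k+1) * r ^ (4*k) * p1\<^sup>2 * p * X\<bar>
        = real (2*k+1) * r ^ (4*k) * p1\<^sup>2 * \<bar>p\<bar> * \<bar>X\<bar>"
      using r by (simp add: abs_mult)
    also have "\<dots> \<le> real n * r ^ (4*k) * p1\<^sup>2 * (2 * r) * M"
      by (intro mult_mono X p order_refl of_nat_mono kn) (use r in auto)
    also have "\<dots> = 2 * M * n * (r ^ (4*k+1) * p1\<^sup>2)" by simp
    also have "r ^ (4*k+1) * p1\<^sup>2 \<le> r ^ (2 * (n + 1)) * p1\<^sup>2"
      by (intro mult_right_mono power_increasing) (use r kn in auto)
    also have "\<dots> = (p1 * r ^ (n + 1))\<^sup>2"
      by (simp only: power_mult_distrib mult.commute flip: power_mult)
    also note P1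
    finally show ?thesis using M by (simp add: mult_left_mono)
  qed
  have "(r\<^sup>2) ^ (2*k+1) * ((- d - X' + X) * X + p * e) - real (2*k+1) * (r\<^sup>2) ^ (2*k) * p1\<^sup>2 * p * X
      = - (r ^ (4*k+2) * (d * X)) - r ^ (4*k+2) * (X' * X) + S\<^sup>2 + E * (p * r ^ (2*k+2))
        - real (2*k+1) * r ^ (4*k) * p1\<^sup>2 * p * X"
    unfolding pw e0[symmetric] e1[symmetric] by (simp add: algebra_simps)
  also have "\<dots> \<ge> S\<^sup>2 - S\<^sup>2 / 4 - b / (4 * a) * E\<^sup>2 - (K * a * U + 4 * U + 2 * M * n * U)"
  proof -
    have up: "r ^ (4*k+2) * y \<le> r ^ (4*k+2) * \<bar>y\<bar>" for y
      using r by (auto intro!: mult_left_mono)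
    have f2: "r ^ (4*k+2) * (X' * X) \<le> S\<^sup>2 / 8 + 2 * U"
      using order_trans[OF order_trans[OF up e2] t2] by simp
    have f3: "r ^ (4*k+2) * (d * X) \<le> S\<^sup>2 / 8 + 2 * U"
      using order_trans[OF order_trans[OF up e3] t3] by simp
    have f1: "- (E * (p * r ^ (2*k+2))) \<le> b / (4 * a) * E\<^sup>2 + K * a * U"
      using order_trans[OF abs_le_D2[OF t1] add_left_mono[OF t1']] .
    have rearrange: "s - s / 4 - g - (h1 + 4 * U + h2) \<le> - x3 - x2 + s + x1 - x4"
      if "x2 \<le> s / 8 + 2 * U" "x3 \<le> s / 8 + 2 * U" "- x1 \<le> g + h1" "x4 \<le> h2"
      for s g h1 h2 x1 x2 x3 x4 :: real
      using that by linarith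
    show ?thesis by (rule rearrange[OF f2 f3 f1 abs_le_D1[OF e4]])
  qed
  finally have main: "S\<^sup>2 - S\<^sup>2 / 4 - b / (4 * a) * E\<^sup>2 - (K * a * U + 4 * U + 2 * M * n * U)
    \<le> (r\<^sup>2) ^ (2*k+1) * ((- d - X' + X) * X + p * e) - real (2*k+1) * (r\<^sup>2) ^ (2*k) * p1\<^sup>2 * p * X" .
  \<comment> \<open>Since \<open>a\<close> is at least 1, all errors can be written as multiples of
    \<open>a * U\<close>, which the final factor \<open>a\<close> turns into multiples of
    \<open>a\<^sup>2 * U\<close>.\<close>
  have "4 * U + 2 * M * n * U \<le> (4 * U + 2 * M * n * U) * a"
    using mult_left_mono[OF a, of "4 * U + 2 * M * n * U"] U M by simp
  then have "S\<^sup>2 - S\<^sup>2 / 4 - b / (4 * a) * E\<^sup>2 - (K + 4 + 2 * M * n) * a * U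
    \<le> (r\<^sup>2) ^ (2*k+1) * ((- d - X' + X) * X + p * e) - real (2*k+1) * (r\<^sup>2) ^ (2*k) * p1\<^sup>2 * p * X"
    using main by (simp add: algebra_simps)
  then have "a * (S\<^sup>2 - S\<^sup>2 / 4 - b / (4 * a) * E\<^sup>2 - (K + 4 + 2 * M * n) * a * U)
    \<le> a * ((r\<^sup>2) ^ (2*k+1) * ((- d - X' + X) * X + p * e) - real (2*k+1) * (r\<^sup>2) ^ (2*k) * p1\<^sup>2 * p * X)"
    using a by (intro mult_left_mono) auto
  moreover have "a * (S\<^sup>2 - S\<^sup>2 / 4 - b / (4 * a) * E\<^sup>2 - (K + 4 + 2 * M * n) * a * U)
    = a * S\<^sup>2 - (a * S\<^sup>2 + b * E\<^sup>2) / 4 - (K + 4 + 2 * M * n) * a\<^sup>2 * U"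
    using a by (simp add: field_simps power2_eq_square)
  ultimately show ?thesis by (simp add: S_def E_def)
qed

lemma even_term_lower_bound:
  fixes r a b c M U X X' X'' e d p1 D B \<Delta> :: real and k n :: nat
  assumes r: "r \<ge> 1" and a: "a \<ge> 1" and b: "b \<ge> 1" and M: "M \<ge> 1" and c: "0 < c" "c \<le> 1"
    and kn: "2 * k \<le> n" and last: "k = 0 \<Longrightarrow> X'' = 0"
    and S: "(X * r ^ (2*k+1))\<^sup>2 \<le> U" and S': "(X' * r ^ (2*k+3))\<^sup>2 \<le> U"
    and d: "(d * r ^ (2*k+2))\<^sup>2 \<le> U" and P1: "(p1 * r ^ (n + 1))\<^sup>2 \<le> U"
    and X: "\<bar>X\<bar> \<le> M" and B: "\<bar>B\<bar> \<le> M" and D: "\<bar>D\<bar> \<le> M" and \<Delta>: "\<bar>\<Delta>\<bar> \<le> 4 * r"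
    and nondeg: "c \<le> X\<^sup>2 + B\<^sup>2" and e: "e = - B * \<Delta>"
  shows "a * ((r\<^sup>2) ^ (2*k) * (e\<^sup>2 + X * (- D * \<Delta>\<^sup>2 - B * (- d - X' + 2 * X - X'')))
           - real (2*k) * (r\<^sup>2) ^ (2*k-1) * p1\<^sup>2 * X * e)
    \<ge> a * (e * r ^ (2*k))\<^sup>2 - (a * (e * r ^ (2*k))\<^sup>2 + b * (X'' * r ^ (2*k-1))\<^sup>2) / 4
      - (4 + 64 * M\<^sup>2 / c + 5 * M\<^sup>2 + 4 * M\<^sup>2 * n) * a\<^sup>2 * U"
proof -
  define T where "T = X * r ^ (2*k+1)"
  define E where "E = e * r ^ (2*k)"
  define Q where "Q = \<Delta> * r ^ (2*k)"
  define Z where "Z = X'' * r ^ (2*k-1)"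
  have r4: "r ^ (4*k) = r ^ (2*k) * r ^ (2*k)" by (simp flip: power_add)
  have U: "U \<ge> 0" using S' by (smt (verit) zero_le_power2)
  have TU: "T\<^sup>2 \<le> U" using S by (simp add: T_def)
  have cQ: "c * Q\<^sup>2 \<le> E\<^sup>2 + 16 * T\<^sup>2"
    using gap_bound[OF r \<Delta> nondeg e, of "r ^ (2*k)"] by (simp add: Q_def E_def T_def mult_ac)
  have pw: "(r\<^sup>2) ^ (2*k) = r ^ (4*k)" by (simp flip: power_mult)
  \<comment> \<open>One factor \<open>\<Delta>\<close> is bounded by \<open>4 * r\<close>, which
    turns \<open>X\<close> into \<open>T\<close>; the other stays in \<open>Q\<close>. The weight
    \<open>c / 4\<close> is chosen so that \<open>cQ\<close> returns exactly a quarter of the square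
    of \<open>E\<close>.\<close>
  have t1: "r ^ (4*k) * \<bar>X * (D * \<Delta>\<^sup>2)\<bar> \<le> E\<^sup>2 / 4 + 4 * U + 64 * M\<^sup>2 / c * U"
  proof -
    have "r ^ (4*k) * \<bar>X * (D * \<Delta>\<^sup>2)\<bar> = r ^ (4*k) * \<bar>X\<bar> * (\<bar>D\<bar> * (\<bar>\<Delta>\<bar> * \<bar>\<Delta>\<bar>))"
      by (simp add: abs_mult power2_eq_square)
    also have "\<dots> \<le> r ^ (4*k) * \<bar>X\<bar> * (M * (4 * r * \<bar>\<Delta>\<bar>))"
      by (intro mult_mono order_refl D \<Delta>) (use r M in auto)
    also have "\<dots> = \<bar>Q * (4 * M * T)\<bar>"
      using r M by (simp add: Q_def T_def abs_mult power_add power2_eq_square r4)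
    also have "\<dots> \<le> c / 4 * Q\<^sup>2 + (4 * M * T)\<^sup>2 / (4 * (c / 4))"
      by (rule abs_mult_le_weighted) (use c in auto)
    also have "\<dots> = c * Q\<^sup>2 / 4 + 16 * M\<^sup>2 / c * T\<^sup>2" by (simp add: power_mult_distrib)
    also have "\<dots> \<le> (E\<^sup>2 + 16 * U) / 4 + 64 * M\<^sup>2 / c * U"
      using cQ TU c by (intro add_mono mult_mono divide_right_mono) auto
    finally show ?thesis by (simp add: add_divide_distrib)
  qed
  have prod: "\<bar>T * y\<bar> \<le> U" if "y\<^sup>2 \<le> U" for y
  proof -
    have "\<bar>T * y\<bar> \<le> 1/2 * T\<^sup>2 + U / (4 * (1/2))"
      by (rule abs_mult_le_weighted') (use that in auto)
    then show ?thesis using TU by simp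
  qed
  have BM: "r ^ (4*k) * \<bar>X * (B * y)\<bar> \<le> M * (r ^ (4*k) * \<bar>X * y\<bar>)" for y
  proof -
    have "r ^ (4*k) * \<bar>X * (B * y)\<bar> = \<bar>B\<bar> * (r ^ (4*k) * \<bar>X * y\<bar>)" by (simp add: abs_mult)
    also have "\<dots> \<le> M * (r ^ (4*k) * \<bar>X * y\<bar>)" using B r by (intro mult_right_mono) auto
    finally show ?thesis .
  qed
  \<comment> \<open>Friction, the preceding force and the force of the bond itself all come earlier
    in the hierarchy, so each is paired with \<open>T\<close> and nothing of \<open>E\<close> is
    spent.\<close>
  have earlier: "r ^ (4*k) * \<bar>X * (B * y)\<bar> \<le> M * U" if "(y * r ^ l)\<^sup>2 \<le> U" "2*k \<le> l + 1" for y l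
  proof -
    have "r ^ (4*k) * \<bar>X * y\<bar> \<le> r ^ (2*k+1+l) * \<bar>X * y\<bar>"
      by (intro mult_right_mono power_increasing) (use r that in auto)
    also have "\<dots> = \<bar>T * (y * r ^ l)\<bar>"
      using r by (simp add: T_def abs_mult power_add)
    also have "\<dots> \<le> U" by (rule prod[OF that(1)])
    finally have "M * (r ^ (4*k) * \<bar>X * y\<bar>) \<le> M * U" using M by (intro mult_left_mono) auto
    with BM[of y] show ?thesis by simp
  qed
  \<comment> \<open>The following force comes later in the hierarchy, so its square must keep the
    weight \<open>b / (4 * a)\<close>. The powers of \<open>r\<close> match exactly, without
    slack.\<close>
  have t2: "r ^ (4*k) * \<bar>X * (B * X'')\<bar> \<le> b / (4 * a) * Z\<^sup>2 + M\<^sup>2 * a * U"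
  proof -
    have eq: "r ^ (4*k) * \<bar>X * X''\<bar> = \<bar>Z * T\<bar>"
    proof (cases k)
      \<comment> \<open>On the last bond the exponent \<open>2*k-1\<close> is truncated to 0, but
        there is no following force.\<close>
      case 0 then show ?thesis using last by (simp add: Z_def)
    next
      case (Suc l)
      then have "4*k = (2*k-1) + (2*k+1)" by simp
      then have "r ^ (4*k) = r ^ (2*k-1) * r ^ (2*k+1)" by (metis power_add)
      then show ?thesis using r by (simp add: Z_def T_def abs_mult)
    qed
    have "M * \<bar>Z * T\<bar> = \<bar>Z * (M * T)\<bar>" using M by (simp add: abs_mult)
    also have "\<dots> \<le> b / (4 * a) * Z\<^sup>2 + M\<^sup>2 * U / (4 * (b / (4 * a)))"
      by (rule abs_mult_le_weighted') (use a b TU in \<open>auto simp: power_mult_distrib mult_left_mono\<close>)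
    also have "M\<^sup>2 * U / (4 * (b / (4 * a))) \<le> M\<^sup>2 * a * U"
    proof -
      have "M\<^sup>2 * U * a / b \<le> M\<^sup>2 * U * a / 1"
        using U a b by (intro divide_left_mono) auto
      then show ?thesis by (simp add: mult_ac)
    qed
    finally show ?thesis using BM[of X''] eq by simp
  qed
  have t3: "\<bar>real (2*k) * (r\<^sup>2) ^ (2*k-1) * p1\<^sup>2 * X * e\<bar> \<le> 4 * M\<^sup>2 * n * U"
  proof -
    have eM: "\<bar>e\<bar> \<le> M * (4 * r)" unfolding e abs_mult abs_minus_cancel
      by (intro mult_mono B \<Delta>) (use M in auto)
    have pw: "r ^ (2 * (2*k-1)) * r \<le> r ^ (2 * (n + 1))"
      unfolding power_Suc2[symmetric] by (intro power_increasing) (use r kn in auto)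
    have "\<bar>real (2*k) * (r\<^sup>2) ^ (2*k-1) * p1\<^sup>2 * X * e\<bar>
        = real (2*k) * (r ^ (2 * (2*k-1))) * p1\<^sup>2 * \<bar>X\<bar> * \<bar>e\<bar>"
      using r by (simp add: abs_mult power_mult)
    also have "\<dots> \<le> real n * (r ^ (2 * (2*k-1))) * p1\<^sup>2 * M * (M * (4 * r))"
      by (intro mult_mono X eM order_refl of_nat_mono kn) (use r M in auto)
    also have "\<dots> = 4 * M\<^sup>2 * n * (r ^ (2 * (2*k-1)) * r * p1\<^sup>2)" by (simp add: power2_eq_square)
    also have "\<dots> \<le> 4 * M\<^sup>2 * n * (r ^ (2 * (n + 1)) * p1\<^sup>2)"
      by (intro mult_left_mono mult_right_mono pw) auto
    also have "r ^ (2 * (n + 1)) * p1\<^sup>2 = (p1 * r ^ (n + 1))\<^sup>2"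
      by (simp only: power_mult_distrib mult.commute flip: power_mult)
    also have "4 * M\<^sup>2 * n * (p1 * r ^ (n + 1))\<^sup>2 \<le> 4 * M\<^sup>2 * n * U"
      by (intro mult_left_mono P1) auto
    finally show ?thesis .
  qed
  have e0: "r ^ (4*k) * e\<^sup>2 = E\<^sup>2"
    by (simp add: E_def power_mult_distrib mult.commute flip: power_mult)
  have "(r\<^sup>2) ^ (2*k) * (e\<^sup>2 + X * (- D * \<Delta>\<^sup>2 - B * (- d - X' + 2 * X - X'')))
           - real (2*k) * (r\<^sup>2) ^ (2*k-1) * p1\<^sup>2 * X * e
      = E\<^sup>2 - r ^ (4*k) * (X * (D * \<Delta>\<^sup>2)) + r ^ (4*k) * (X * (B * d)) + r ^ (4*k) * (X * (B * X'))
        - 2 * (r ^ (4*k) * (X * (B * X))) + r ^ (4*k) * (X * (B * X''))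
        - real (2*k) * (r\<^sup>2) ^ (2*k-1) * p1\<^sup>2 * X * e"
    unfolding pw e0[symmetric] by (simp add: algebra_simps)
  also have "\<dots> \<ge> E\<^sup>2 - E\<^sup>2 / 4 - b / (4 * a) * Z\<^sup>2
      - (4 * U + 64 * M\<^sup>2 / c * U + 4 * (M * U) + M\<^sup>2 * a * U + 4 * M\<^sup>2 * n * U)"
  proof -
    have up: "y \<le> \<bar>y\<bar>" "- y \<le> \<bar>y\<bar>" for y :: real by auto
    have rr: "r ^ (4*k) * y \<le> r ^ (4*k) * \<bar>y\<bar>" "- (r ^ (4*k) * y) \<le> r ^ (4*k) * \<bar>y\<bar>" for y
      using mult_left_mono[OF up(1)[of y], of "r ^ (4*k)"] mult_left_mono[OF up(2)[of y], of "r ^ (4*k)"] r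
      by auto
    have rearrange: "E\<^sup>2 - E\<^sup>2 / 4 - g - (4 * U + h1 + 4 * h2 + h3 + h4) \<le> E\<^sup>2 - x1 + x2 + x3 - 2 * x4 + x5 - x6"
      if "x1 \<le> E\<^sup>2 / 4 + 4 * U + h1" "- x2 \<le> h2" "- x3 \<le> h2" "x4 \<le> h2" "- x5 \<le> g + h3" "x6 \<le> h4"
      for g h1 h2 h3 h4 x1 x2 x3 x4 x5 x6
      using that by linarith
    show ?thesis
      by (rule rearrange[OF order_trans[OF rr(1) t1] order_trans[OF rr(2) earlier[OF d]]
            order_trans[OF rr(2) earlier[OF S']] order_trans[OF rr(1) earlier[OF S]]
            order_trans[OF rr(2) t2] abs_le_D1[OF t3]]) auto
  qed
  finally have main: "E\<^sup>2 - E\<^sup>2 / 4 - b / (4 * a) * Z\<^sup>2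
      - (4 * U + 64 * M\<^sup>2 / c * U + 4 * (M * U) + M\<^sup>2 * a * U + 4 * M\<^sup>2 * n * U)
    \<le> (r\<^sup>2) ^ (2*k) * (e\<^sup>2 + X * (- D * \<Delta>\<^sup>2 - B * (- d - X' + 2 * X - X'')))
           - real (2*k) * (r\<^sup>2) ^ (2*k-1) * p1\<^sup>2 * X * e" (is "_ \<le> ?R") .
  have "4 * U + 64 * M\<^sup>2 / c * U + 4 * (M * U) + 4 * M\<^sup>2 * n * U
      \<le> 4 * U + 64 * M\<^sup>2 / c * U + 4 * (M\<^sup>2 * U) + 4 * M\<^sup>2 * n * U"
    using M U by (simp add: power2_eq_square mult_right_mono)
  also have "\<dots> \<le> (4 * U + 64 * M\<^sup>2 / c * U + 4 * (M\<^sup>2 * U) + 4 * M\<^sup>2 * n * U) * a"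
    using mult_left_mono[OF a, of "4 * U + 64 * M\<^sup>2 / c * U + 4 * (M\<^sup>2 * U) + 4 * M\<^sup>2 * n * U"] U M c by simp
  finally have "E\<^sup>2 - E\<^sup>2 / 4 - b / (4 * a) * Z\<^sup>2 - (4 + 64 * M\<^sup>2 / c + 5 * M\<^sup>2 + 4 * M\<^sup>2 * n) * a * U \<le> ?R"
    using main by (simp add: algebra_simps)
  then have "a * (E\<^sup>2 - E\<^sup>2 / 4 - b / (4 * a) * Z\<^sup>2 - (4 + 64 * M\<^sup>2 / c + 5 * M\<^sup>2 + 4 * M\<^sup>2 * n) * a * U)
      \<le> a * ?R"
    using a by (intro mult_left_mono) auto
  moreover have "a * (E\<^sup>2 - E\<^sup>2 / 4 - b / (4 * a) * Z\<^sup>2 - L * a * U)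
    = a * E\<^sup>2 - (a * E\<^sup>2 + b * Z\<^sup>2) / 4 - L * a\<^sup>2 * U" for L
    using a by (simp add: field_simps power2_eq_square)
  ultimately show ?thesis by (simp add: E_def Z_def)
qed

lemma sum_pairs: "(\<Sum>m=1..2*n. f m) = (\<Sum>j=1..n. f (2*j-1) + f (2*j))"
  for f :: "nat \<Rightarrow> 'a::comm_monoid_add"
  by (induction n) (simp_all add: add.assoc)

text \<open>The quarters of current and next squares add up to at most half of the weighted sum over
  \<open>m \<ge> 1\<close>, because the shifted sum ends in \<open>Y (Suc n) = 0\<close>. The
  remaining errors cost at most a quarter of the full weighted sum, so a quarter of it is
  left.\<close>

lemma hierarchical_sum_lower_bound:
  fixes a Y T :: "nat \<Rightarrow> real" and K :: real and n :: nat
  assumes K: "K \<ge> 0" and a: "\<And>k. k \<le> n \<Longrightarrow> a k \<ge> 1"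
    and dom: "\<And>k. k < n \<Longrightarrow> 4 * K * (\<Sum>m=Suc k..n. (a m)\<^sup>2) \<le> a k"
    and last: "Y (Suc n) = 0"
    and T: "\<And>m. m \<in> {1..n} \<Longrightarrow> T m \<ge> a m * (Y m)\<^sup>2
       - (a m * (Y m)\<^sup>2 + a (Suc m) * (Y (Suc m))\<^sup>2) / 4 - K * (a m)\<^sup>2 * (\<Sum>k<m. (Y k)\<^sup>2)"
  shows "(\<Sum>k\<le>n. (Y k)\<^sup>2) / 4 \<le> a 0 * (Y 0)\<^sup>2 + (\<Sum>m=1..n. T m)"
proof -
  define G where "G m = a m * (Y m)\<^sup>2" for m
  define R where "R = (\<Sum>m=1..n. K * (a m)\<^sup>2 * (\<Sum>k<m. (Y k)\<^sup>2))"
  have G: "G k \<ge> (Y k)\<^sup>2" if "k \<le> n" for k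
    using mult_right_mono[OF a[OF that], of "(Y k)\<^sup>2"] by (simp add: G_def)
  have G0: "G k \<ge> 0" if "k \<le> n" for k using order_trans[OF _ G[OF that]] by simp
  have split: "(\<Sum>k\<le>n. G k) = G 0 + (\<Sum>m=1..n. G m)"
    using sum.atLeast_Suc_atMost[of 0 n G] by (simp add: atLeast0AtMost)
  have shift: "(\<Sum>m=1..n. G (Suc m)) \<le> (\<Sum>m=1..n. G m)"
  proof (cases n)
    case (Suc l)
    have "(\<Sum>m=1..n. G (Suc m)) = (\<Sum>m=1..l. G (Suc m)) + G (Suc n)" by (simp add: Suc)
    also have "G (Suc n) = 0" using last by (simp add: G_def)
    also have "(\<Sum>m=1..l. G (Suc m)) = (\<Sum>m=2..n. G m)"
      unfolding Suc by (metis One_nat_def Suc_1 sum.shift_bounds_cl_Suc_ivl)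
    finally have "(\<Sum>m=1..n. G (Suc m)) = (\<Sum>m=2..n. G m)" by simp
    also have "\<dots> \<le> (\<Sum>m=1..n. G m)" by (rule sum_mono2) (auto intro: G0)
    finally show ?thesis .
  qed simp
  \<comment> \<open>Exchanging the sums collects, for each \<open>k\<close>, the squares of all
    later coefficients in front of the square of \<open>Y k\<close>; this is what \<open>dom\<close>
    bounds by \<open>a k\<close>.\<close>
  have R: "R \<le> (\<Sum>k\<le>n. G k) / 4"
  proof -
    have "R = (\<Sum>m=0..n. \<Sum>k=0..<m. K * (a m)\<^sup>2 * (Y k)\<^sup>2)"
      unfolding R_def by (simp add: sum_distrib_left sum.atLeast_Suc_atMost lessThan_atLeast0)
    also have "\<dots> = (\<Sum>k=0..<n. \<Sum>m=Suc k..n. K * (a m)\<^sup>2 * (Y k)\<^sup>2)"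
      by (rule sum.nested_swap)
    also have "\<dots> = (\<Sum>k=0..<n. (4 * K * (\<Sum>m=Suc k..n. (a m)\<^sup>2)) * (Y k)\<^sup>2 / 4)"
      by (simp add: sum_distrib_left sum_distrib_right sum_divide_distrib mult.assoc)
    also have "\<dots> \<le> (\<Sum>k=0..<n. a k * (Y k)\<^sup>2 / 4)"
      by (intro sum_mono divide_right_mono mult_right_mono dom) auto
    also have "\<dots> \<le> (\<Sum>k\<le>n. a k * (Y k)\<^sup>2 / 4)"
      by (rule sum_mono2) (use G0 in \<open>auto simp: G_def\<close>)
    finally show ?thesis by (simp add: G_def sum_divide_distrib)
  qed
  have "(\<Sum>m=1..n. G m) - ((\<Sum>m=1..n. G m) + (\<Sum>m=1..n. G (Suc m))) / 4 - R
      = (\<Sum>m=1..n. G m - (G m + G (Suc m)) / 4 - K * (a m)\<^sup>2 * (\<Sum>k<m. (Y k)\<^sup>2))"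
    by (simp add: R_def sum_subtractf sum.distrib flip: sum_divide_distrib)
  also have "\<dots> \<le> (\<Sum>m=1..n. T m)"
    by (intro sum_mono) (use T in \<open>simp add: G_def\<close>)
  finally have sumT: "(\<Sum>m=1..n. G m) - ((\<Sum>m=1..n. G m) + (\<Sum>m=1..n. G (Suc m))) / 4 - R
      \<le> (\<Sum>m=1..n. T m)" .
  have "(\<Sum>k\<le>n. G k) / 4 \<le> G 0 + (\<Sum>m=1..n. T m)"
  proof -
    have "s / 4 \<le> g + t"
      if "s1 - (s1 + s2) / 4 - R \<le> t" "s = g + s1" "s2 \<le> s1" "R \<le> s / 4" "0 \<le> g" for s s1 s2 t g :: real
      using that by (simp add: field_simps)
    from this[OF sumT split shift R G0] show ?thesis by simp
  qed
  moreover  moreover have "(\<Sum>k\<le>n. (Y k)\<^sup>2) \<le> (\<Sum>k\<le>n. G k)" by (intro sum_mono G) simp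
  ultimately show ?thesis by (simp add: G_def)
qed

section \<open>The chain of rotators\<close>

text \<open>Periodicity enters the dynamics only through these uniform bounds, which compactness of
  the circle supplies. Three derivatives appear because \<open>W\<close> contains second derivatives
  of the potentials through the Lie derivative of \<open>xi\<close>, and is differentiated once
  more.\<close>

locale rotator_chain =
  fixes N :: nat and V :: "nat \<Rightarrow> real \<Rightarrow> real" and M c :: real
  assumes N: "N \<ge> 2" and M: "M \<ge> 1" and c: "0 < c" "c \<le> 1"
    and DV: "\<And>j u. j \<in> {1..N-1} \<Longrightarrow> (V j has_real_derivative deriv (V j) u) (at u)"
      "\<And>j u. j \<in> {1..N-1} \<Longrightarrow> (deriv (V j) has_real_derivative deriv (deriv (V j)) u) (at u)"
      "\<And>j u. j \<in> {1..N-1} \<Longrightarrow>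
         (deriv (deriv (V j)) has_real_derivative deriv (deriv (deriv (V j))) u) (at u)"
    and V1: "\<And>j u. j \<in> {1..N-1} \<Longrightarrow> 1 \<le> V j u"
    and bounds: "\<And>j u. j \<in> {1..N-1} \<Longrightarrow> V j u \<le> M"
      "\<And>j u. j \<in> {1..N-1} \<Longrightarrow> \<bar>deriv (V j) u\<bar> \<le> M"
      "\<And>j u. j \<in> {1..N-1} \<Longrightarrow> \<bar>deriv (deriv (V j)) u\<bar> \<le> M"
      "\<And>j u. j \<in> {1..N-1} \<Longrightarrow> \<bar>deriv (deriv (deriv (V j))) u\<bar> \<le> M"
    and nondeg: "\<And>j u. j \<in> {1..N-1} \<Longrightarrow> c \<le> (deriv (V j) u)\<^sup>2 + (deriv (deriv (V j)) u)\<^sup>2"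
begin

section \<open>Observables and their rates along the flow\<close>

abbreviation energy :: "state \<Rightarrow> real" where "energy \<equiv> hamiltonian N V"

definition angle :: "nat \<Rightarrow> state \<Rightarrow> real" where "angle j x = snd x j - snd x (j + 1)"

definition gap :: "nat \<Rightarrow> state \<Rightarrow> real" where "gap j x = fst x j - fst x (j + 1)"

text \<open>Unlike \<^const>\<open>xi\<close>, the force is defined (as \<open>0\<close>) on the missing bonds \<open>0\<close> and \<open>N\<close> as well.\<close>

definition force :: "nat \<Rightarrow> state \<Rightarrow> real" where
  "force j x = - deriv (ext_pot N V j) (angle j x)"

definition force_rate :: "nat \<Rightarrow> state \<Rightarrow> real" where
  "force_rate j x = - deriv (deriv (V j)) (angle j x) * gap j x"

definition friction :: "nat \<Rightarrow> state \<Rightarrow> real" where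
  "friction j x = (if j = 1 then fst x 1 else 0)"

definition momentum_rate :: "nat \<Rightarrow> state \<Rightarrow> real" where
  "momentum_rate j x = - friction j x - force (j - 1) x + force j x"

definition force_rate2 :: "nat \<Rightarrow> state \<Rightarrow> real" where
  "force_rate2 j x = - deriv (deriv (deriv (V j))) (angle j x) * (gap j x)\<^sup>2
     - deriv (deriv (V j)) (angle j x) * (momentum_rate j x - momentum_rate (j + 1) x)"

definition odd_rate :: "real \<Rightarrow> nat \<Rightarrow> state \<Rightarrow> real" where
  "odd_rate a j x = a * (energy x ^ alpha N (2*j-1) * (momentum_rate j x * force j x + fst x j * force_rate j x)
     - real (alpha N (2*j-1)) * energy x ^ (alpha N (2*j-1) - 1) * (fst x 1)\<^sup>2 * fst x j * force j x)"

text \<open>As for \<open>odd_rate\<close>, the last product comes from the dissipation of energy.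
  For \<open>j = N - 1\<close> the exponent \<open>alpha N (2*j) - 1\<close> is truncated, and the
  factor \<open>real (alpha N (2*j))\<close> is 0.\<close>

definition even_rate :: "real \<Rightarrow> nat \<Rightarrow> state \<Rightarrow> real" where
  "even_rate a j x = a * (energy x ^ alpha N (2*j) * ((force_rate j x)\<^sup>2 + force j x * force_rate2 j x)
     - real (alpha N (2*j)) * energy x ^ (alpha N (2*j) - 1) * (fst x 1)\<^sup>2 * force j x * force_rate j x)"

definition lyapunov_rate :: "(nat \<Rightarrow> real) \<Rightarrow> state \<Rightarrow> real" where
  "lyapunov_rate a x = - (a 0 * (real (gamma0 N) * energy x ^ (gamma0 N - 1) * (fst x 1)\<^sup>2)
     + (\<Sum>j=1..N-1. odd_rate (a (2*j-1)) j x + even_rate (a (2*j)) j x))"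

text \<open>These are the quantities \<open>Y\<^sub>m\<close> weighted by powers of the root of the
  energy. The index \<open>2*N - 1\<close> gives the force on the missing bond \<open>N\<close>,
  which is 0 and closes the hierarchy.\<close>

definition scaled :: "nat \<Rightarrow> state \<Rightarrow> real" where
  "scaled m x = (if m = 0 then fst x 1 else if odd m then force ((m + 1) div 2) x else force_rate (m div 2) x)
     * sqrt (energy x) ^ (2*N - 2 - m)"

section \<open>Elementary bounds by the energy\<close>

lemma force_eq_xi: "j \<in> {1..N-1} \<Longrightarrow> force j x = xi V j x"
  by (cases x) (simp add: force_def xi_def ext_pot_def angle_def)

lemma force_missing [simp]: "force 0 x = 0" "force N x = 0"
  using N by (auto simp: force_def ext_pot_def)

lemma force_bound: "\<bar>force j x\<bar> \<le> M"
  using bounds(2)[of j] M by (auto simp: force_def ext_pot_def)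

lemma potential_bounds:
  "(\<Sum>j=1..N-1. V j (angle j x)) \<ge> real (N - 1)"
  "(\<Sum>j=1..N-1. V j (angle j x)) \<le> real (N - 1) * M"
  using sum_mono[of "{1..N-1}" "\<lambda>_. 1" "\<lambda>j. V j (angle j x)"] V1
    sum_mono[of "{1..N-1}" "\<lambda>j. V j (angle j x)" "\<lambda>_. M"] bounds(1) by auto

lemma energy_eq: "energy x = (\<Sum>j=1..N. (fst x j)\<^sup>2 / 2) + (\<Sum>j=1..N-1. V j (angle j x))"
  by (cases x) (simp add: hamiltonian_def angle_def)

lemma energy_ge_1: "energy x \<ge> 1"
  using potential_bounds(1)[of x] N sum_nonneg[of "{1..N}" "\<lambda>j. (fst x j)\<^sup>2 / 2"]
  unfolding energy_eq by simp

lemma sqrt_energy: "sqrt (energy x) \<ge> 1" "(sqrt (energy x))\<^sup>2 = energy x"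
  using energy_ge_1[of x] by auto

lemma momentum_bound:
  assumes "j \<in> {1..N}" shows "\<bar>fst x j\<bar> \<le> 2 * sqrt (energy x)"
proof -
  have "(fst x j)\<^sup>2 / 2 \<le> (\<Sum>j=1..N. (fst x j)\<^sup>2 / 2)"
    using assms by (intro member_le_sum) auto
  also have "\<dots> \<le> energy x" using potential_bounds(1)[of x] unfolding energy_eq by simp
  finally have "(fst x j)\<^sup>2 \<le> (2 * sqrt (energy x))\<^sup>2"
    using energy_ge_1[of x] by (simp add: power_mult_distrib)
  then have "\<bar>fst x j\<bar>\<^sup>2 \<le> (2 * sqrt (energy x))\<^sup>2" by simp
  then show ?thesis by (rule power2_le_imp_le) (use sqrt_energy(1)[of x] in simp)
qed

lemma gap_le:
  assumes "j \<in> {1..N-1}" shows "\<bar>gap j x\<bar> \<le> 4 * sqrt (energy x)"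
proof -
  have "j \<in> {1..N}" "j + 1 \<in> {1..N}" using assms by auto
  from momentum_bound[OF this(1), of x] momentum_bound[OF this(2), of x] show ?thesis
    by (simp add: gap_def)
qed

lemma nondeg_force:
  assumes "j \<in> {1..N-1}" shows "c \<le> (force j x)\<^sup>2 + (deriv (deriv (V j)) (angle j x))\<^sup>2"
  using nondeg[OF assms] assms by (simp add: force_def ext_pot_def)

lemma scaled_simps:
  "scaled 0 x = fst x 1 * sqrt (energy x) ^ (2*N - 2)"
  "j \<ge> 1 \<Longrightarrow> scaled (2*j-1) x = force j x * sqrt (energy x) ^ (2*N - 1 - 2*j)"
  "j \<ge> 1 \<Longrightarrow> scaled (2*j) x = force_rate j x * sqrt (energy x) ^ (2*N - 2 - 2*j)"
proof -
  assume j: "j \<ge> 1"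
  have "odd (2*j-1)" "(2*j-1+1) div 2 = j" "2*j-1 \<noteq> 0" "2*N-2-(2*j-1) = 2*N-1-2*j" using j by auto
  then show "scaled (2*j-1) x = force j x * sqrt (energy x) ^ (2*N - 1 - 2*j)"
    by (simp add: scaled_def)
qed (auto simp: scaled_def)

section \<open>Control of the momenta by the scaled quantities\<close>

text \<open>The factor \<open>32 / c\<close> is twice the loss in \<open>gap_bound\<close>; each
  bond crossed costs another factor 3.\<close>

definition momentum_const :: real where "momentum_const = 32 / c * 3 ^ N"

text \<open>Induction along the chain: the next momentum is the present one minus the gap, and
  \<open>gap_bound\<close> controls the gap by the two scaled quantities of the bond. The first
  momentum is \<open>scaled 0\<close> itself.\<close>

lemma scaled_momentum_bound:
  assumes "j \<in> {1..N}"
  shows "(fst x j * sqrt (energy x) ^ (2*N - 2*j))\<^sup>2 \<le> momentum_const * (\<Sum>k<2*j-1. (scaled k x)\<^sup>2)"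
proof -
  define r where "r = sqrt (energy x)"
  have r: "r \<ge> 1" using sqrt_energy by (simp add: r_def)
  have "(fst x (Suc j) * r ^ (2*N - 2*Suc j))\<^sup>2 \<le> 32 / c * 3 ^ j * (\<Sum>k<2*Suc j-1. (scaled k x)\<^sup>2)"
    if "Suc j \<le> N" for j
    using that
  proof (induction j)
    case 0
    have "1 \<le> 32 / c" using c by simp
    then have "1 * (scaled 0 x)\<^sup>2 \<le> 32 / c * (scaled 0 x)\<^sup>2" by (intro mult_right_mono) auto
    then show ?case by (simp add: scaled_simps(1) r_def)
  next
    case (Suc j)
    define i where "i = Suc j"
    have i: "i \<in> {1..N-1}" using Suc.prems by (auto simp: i_def)
    define w where "w = r ^ (2*N - 2*Suc i)"
    define U where "U = (\<Sum>k<2*i-1. (scaled k x)\<^sup>2)"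
    have U: "U \<ge> 0" by (auto simp: U_def intro: sum_nonneg)
    have sumU: "(\<Sum>k<2*Suc i-1. (scaled k x)\<^sup>2) = U + (scaled (2*i-1) x)\<^sup>2 + (scaled (2*i) x)\<^sup>2"
    proof -
      have eq: "2*Suc i-1 = Suc (Suc (2*i-1))" "Suc (2*i-1) = 2*i" using i by auto
      show ?thesis unfolding eq(1) sum.lessThan_Suc unfolding eq(2) U_def ..
    qed
    have e1: "scaled (2*i-1) x = force i x * (r * w)"
    proof -
      have "2*N-1-2*i = Suc (2*N-2*Suc i)" using i by auto
      then show ?thesis using scaled_simps(2)[of i x] i by (simp add: w_def r_def)
    qed
    have e2: "scaled (2*i) x = force_rate i x * w"
      using scaled_simps(3)[of i x] i by (simp add: w_def r_def)
    have g: "c * (gap i x * w)\<^sup>2 \<le> (scaled (2*i) x)\<^sup>2 + 16 * (scaled (2*i-1) x)\<^sup>2"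
      unfolding e1 e2
      by (rule gap_bound[OF r _ nondeg_force[OF i]])
        (use gap_le[OF i] in \<open>auto simp: r_def force_rate_def\<close>)
    \<comment> \<open>The weight drops by two powers of \<open>r\<close> per bond, so the induction
      hypothesis bounds more than is required here.\<close>
    have "w \<le> r ^ (2*N - 2*i)" unfolding w_def using r by (intro power_increasing) auto
    then have "(fst x i * w)\<^sup>2 \<le> (fst x i * r ^ (2*N - 2*i))\<^sup>2"
      unfolding power_mult_distrib using r by (intro mult_left_mono power_mono) (auto simp: w_def)
    also have "\<dots> \<le> 32 / c * 3 ^ j * U"
      using Suc.IH Suc.prems by (simp add: i_def U_def)
    finally have p: "(fst x i * w)\<^sup>2 \<le> 32 / c * 3 ^ j * U" .
    have "(fst x (Suc i) * w)\<^sup>2 = (fst x i * w - gap i x * w)\<^sup>2"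
      by (simp add: gap_def algebra_simps)
    also have "\<dots> \<le> 2 * (fst x i * w)\<^sup>2 + 2 * (gap i x * w)\<^sup>2"
      using sum_squares_bound[of "fst x i * w" "- (gap i x * w)"] by (simp add: power2_diff)
    also have "2 * (gap i x * w)\<^sup>2 \<le> 2 * (((scaled (2*i) x)\<^sup>2 + 16 * (scaled (2*i-1) x)\<^sup>2) / c)"
      using g c by (simp add: field_simps)
    also have "\<dots> \<le> 32 / c * ((scaled (2*i-1) x)\<^sup>2 + (scaled (2*i) x)\<^sup>2)"
      using c by (simp add: field_simps)
    also have "\<dots> \<le> 32 / c * 3 ^ i * ((scaled (2*i-1) x)\<^sup>2 + (scaled (2*i) x)\<^sup>2)"
      using mult_left_mono[OF one_le_power, of 3 "32 / c" i] c by (intro mult_right_mono) auto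
    also have "2 * (fst x i * w)\<^sup>2 \<le> 32 / c * 3 ^ i * U"
    proof -
      have "2 * (32 / c * 3 ^ j * U) \<le> 3 * (32 / c * 3 ^ j * U)"
        using U c by (intro mult_right_mono) auto
      then show ?thesis using p by (simp add: i_def)
    qed
    finally show ?case using sumU by (simp add: w_def i_def algebra_simps)
  qed
  moreover have eq: "Suc (j - 1) = j" using assms by auto
  ultimately have bound: "j \<le> N \<Longrightarrow> (fst x j * r ^ (2*N - 2*j))\<^sup>2 \<le> 32 / c * 3 ^ (j - 1) * (\<Sum>k<2*j-1. (scaled k x)\<^sup>2)"
    by (metis (no_types, lifting))
  have "(fst x j * r ^ (2*N - 2*j))\<^sup>2 \<le> 32 / c * 3 ^ (j - 1) * (\<Sum>k<2*j-1. (scaled k x)\<^sup>2)"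
    by (rule bound) (use assms in auto)
  also have "\<dots> \<le> momentum_const * (\<Sum>k<2*j-1. (scaled k x)\<^sup>2)"
    unfolding momentum_const_def using assms c
    by (intro mult_right_mono mult_left_mono power_increasing sum_nonneg) auto
  finally show ?thesis by (simp add: r_def)
qed

section \<open>Dissipation produced by each term of the Lyapunov function\<close>

text \<open>Large enough for both kinds of terms, so that the whole hierarchy is run with a single
  constant.\<close>

definition rate_const :: real where
  "rate_const = momentum_const + 4 + 64 * M\<^sup>2 / c + 5 * M\<^sup>2 + (2 * M + 4 * M\<^sup>2) * real (2*N - 3)"

lemma rate_const_bounds:
  "momentum_const \<ge> 0" "momentum_const + 4 + 2 * M * real (2*N-3) \<le> rate_const"
  "4 + 64 * M\<^sup>2 / c + 5 * M\<^sup>2 + 4 * M\<^sup>2 * real (2*N-3) \<le> rate_const"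
  using c M by (auto simp: rate_const_def momentum_const_def algebra_simps)

lemma scaled_sq_le: "k < m \<Longrightarrow> (scaled k x)\<^sup>2 \<le> (\<Sum>k<m. (scaled k x)\<^sup>2)"
  by (intro member_le_sum) auto

lemma scaled_first_le: "m \<ge> 1 \<Longrightarrow> (fst x 1 * sqrt (energy x) ^ (2*N - 3 + 1))\<^sup>2 \<le> (\<Sum>k<m. (scaled k x)\<^sup>2)"
proof -
  assume m: "m \<ge> 1"
  have eq: "2*N - 3 + 1 = 2*N - 2" using N by auto
  show ?thesis unfolding eq scaled_simps(1)[symmetric] using m by (intro scaled_sq_le) auto
qed

lemma scaled_previous_le:
  assumes "j \<in> {1..N-1}" "m \<ge> 2*j-1"
  shows "(force (j-1) x * sqrt (energy x) ^ (2*(N-1-j)+3))\<^sup>2 \<le> (\<Sum>k<m. (scaled k x)\<^sup>2)"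
proof (cases "j = 1")
  case False
  have "2*N-1-2*(j-1) = 2*(N-1-j)+3" using assms False by auto
  then show ?thesis using scaled_sq_le[of "2*(j-1)-1" m x] scaled_simps(2)[of "j-1" x] assms False by auto
qed (auto intro: sum_nonneg)

lemma scaled_friction_le:
  assumes "j \<in> {1..N-1}" "m \<ge> 1"
  shows "(friction j x * sqrt (energy x) ^ (2*(N-1-j)+2))\<^sup>2 \<le> (\<Sum>k<m. (scaled k x)\<^sup>2)"
proof (cases "j = 1")
  case True
  have "2*N-2 = 2*(N-1-1)+2" using N by auto
  then show ?thesis using scaled_sq_le[of 0 m x] scaled_simps(1)[of x] assms True by (simp add: friction_def)
qed (auto simp: friction_def intro: sum_nonneg)

text \<open>Counting bonds from the far end, \<open>k = N - 1 - j\<close>, puts the exponents into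
  the form of \<open>odd_term_lower_bound\<close>. The momentum \<open>p_j\<close> is controlled by
  scaled quantities of index below \<open>2*j-1\<close> alone, so it counts as an earlier
  quantity.\<close>

lemma odd_rate_lower_bound:
  assumes j: "j \<in> {1..N-1}" and a: "a \<ge> 1" and b: "b \<ge> 1"
  shows "odd_rate a j x \<ge> a * (scaled (2*j-1) x)\<^sup>2
     - (a * (scaled (2*j-1) x)\<^sup>2 + b * (scaled (2*j) x)\<^sup>2) / 4 - rate_const * a\<^sup>2 * (\<Sum>k<2*j-1. (scaled k x)\<^sup>2)"
proof -
  define k where "k = N - 1 - j"
  define r where "r = sqrt (energy x)"
  define U where "U = (\<Sum>k<2*j-1. (scaled k x)\<^sup>2)"
  have U: "U \<ge> 0" by (auto simp: U_def intro: sum_nonneg)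
  have ks: "2*N - 2*j = 2*k+2" "2*N-1-2*j = 2*k+1" "2*N-2-2*j = 2*k" "alpha N (2*j-1) = 2*k+1"
    using j by (auto simp: k_def alpha_def)
  have sc: "scaled (2*j-1) x = force j x * r ^ (2*k+1)" "scaled (2*j) x = force_rate j x * r ^ (2*k)"
    using scaled_simps(2,3)[of j x, unfolded ks] j by (auto simp: r_def)
  have er: "energy x = r\<^sup>2" using sqrt_energy by (simp add: r_def)
  have "odd_rate a j x \<ge> a * (force j x * r ^ (2*k+1))\<^sup>2
     - (a * (force j x * r ^ (2*k+1))\<^sup>2 + b * (force_rate j x * r ^ (2*k))\<^sup>2) / 4
     - (momentum_const + 4 + 2 * M * real (2*N-3)) * a\<^sup>2 * U"
    unfolding odd_rate_def ks er momentum_rate_def add_diff_cancel_right'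
  proof (rule odd_term_lower_bound)
    show "(fst x j * r ^ (2*k+2))\<^sup>2 \<le> momentum_const * U"
      using scaled_momentum_bound[of j x] j by (auto simp: ks U_def r_def)
    show "(force (j - 1) x * r ^ (2*k+3))\<^sup>2 \<le> U"
      using scaled_previous_le[OF j, of "2*j-1" x] by (simp add: k_def r_def U_def)
    show "(friction j x * r ^ (2*k+2))\<^sup>2 \<le> U"
      unfolding k_def r_def U_def using j by (intro scaled_friction_le) auto
    show "(fst x 1 * r ^ (2*N-3+1))\<^sup>2 \<le> U"
      unfolding r_def U_def using j by (intro scaled_first_le) auto
    show "\<bar>fst x j\<bar> \<le> 2 * r" using momentum_bound[of j x] j by (auto simp: r_def)
    show "1 \<le> r" using sqrt_energy by (simp add: r_def)
    show "2*k+1 \<le> 2*N-3" using j by (auto simp: k_def)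
  qed (use a b M rate_const_bounds force_bound in auto)
  moreover have "(momentum_const + 4 + 2 * M * real (2*N-3)) * (a\<^sup>2 * U) \<le> rate_const * (a\<^sup>2 * U)"
    by (intro mult_right_mono rate_const_bounds) (use U in auto)
  ultimately show ?thesis unfolding sc U_def[symmetric] by (simp add: mult.assoc)
qed

lemma even_rate_lower_bound:
  assumes j: "j \<in> {1..N-1}" and a: "a \<ge> 1" and b: "j < N - 1 \<Longrightarrow> b \<ge> 1"
  shows "even_rate a j x \<ge> a * (scaled (2*j) x)\<^sup>2
     - (a * (scaled (2*j) x)\<^sup>2 + b * (scaled (2*j+1) x)\<^sup>2) / 4 - rate_const * a\<^sup>2 * (\<Sum>k<2*j. (scaled k x)\<^sup>2)"
proof -
  define k where "k = N - 1 - j"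
  define r where "r = sqrt (energy x)"
  define U where "U = (\<Sum>k<2*j. (scaled k x)\<^sup>2)"
  \<comment> \<open>On the last bond \<open>b\<close> is arbitrary; replacing it by 1 changes
    nothing, since it multiplies the vanishing force on bond \<open>N\<close>.\<close>
  define b' where "b' = (if j < N - 1 then b else 1)"
  have U: "U \<ge> 0" by (auto simp: U_def intro: sum_nonneg)
  have ks: "2*N-1-2*j = 2*k+1" "2*N-2-2*j = 2*k" "alpha N (2*j) = 2*k" "2*N-1-2*(j+1) = 2*k-1"
    using j by (auto simp: k_def alpha_def)
  have sc: "scaled (2*j-1) x = force j x * r ^ (2*k+1)" "scaled (2*j) x = force_rate j x * r ^ (2*k)"
    using scaled_simps(2,3)[of j x, unfolded ks] j by (auto simp: r_def)
  have er: "energy x = r\<^sup>2" using sqrt_energy by (simp add: r_def)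
  have last: "force (j+1) x = 0" if "k = 0"
  proof -
    have "j + 1 = N" using that j by (auto simp: k_def)
    then show ?thesis by simp
  qed
  \<comment> \<open>The rotator \<open>j + 1\<close> has no friction, and the force of bond
    \<open>j\<close> acts on its two ends with opposite signs, hence the factor 2.\<close>
  have mr: "momentum_rate j x - momentum_rate (j+1) x
      = - friction j x - force (j-1) x + 2 * force j x - force (j+1) x"
    using j by (simp add: momentum_rate_def friction_def)
  have "even_rate a j x \<ge> a * (force_rate j x * r ^ (2*k))\<^sup>2
     - (a * (force_rate j x * r ^ (2*k))\<^sup>2 + b' * (force (j+1) x * r ^ (2*k-1))\<^sup>2) / 4
     - (4 + 64 * M\<^sup>2 / c + 5 * M\<^sup>2 + 4 * M\<^sup>2 * real (2*N-3)) * a\<^sup>2 * U"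
    unfolding even_rate_def ks er force_rate2_def mr
  proof (rule even_term_lower_bound)
    show "(force j x * r ^ (2*k+1))\<^sup>2 \<le> U"
      using scaled_sq_le[of "2*j-1" "2*j" x] scaled_simps(2)[of j x, unfolded ks] j by (simp add: r_def U_def)
    show "(force (j - 1) x * r ^ (2*k+3))\<^sup>2 \<le> U"
      using scaled_previous_le[OF j, of "2*j" x] by (simp add: k_def r_def U_def)
    show "(friction j x * r ^ (2*k+2))\<^sup>2 \<le> U"
      unfolding k_def r_def U_def using j by (intro scaled_friction_le) auto
    show "(fst x 1 * r ^ (2*N-3+1))\<^sup>2 \<le> U"
      unfolding r_def U_def using j by (intro scaled_first_le) auto
    show "\<bar>gap j x\<bar> \<le> 4 * r" using gap_le[OF j] by (simp add: r_def)
    show "1 \<le> r" using sqrt_energy by (simp add: r_def)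
    show "2*k \<le> 2*N-3" using j by (auto simp: k_def)
    show "1 \<le> b'" using b by (simp add: b'_def)
  qed (use a M c last force_bound bounds(3,4)[OF j] nondeg_force[OF j] in \<open>auto simp: force_rate_def\<close>)
  moreover have "(4 + 64 * M\<^sup>2 / c + 5 * M\<^sup>2 + 4 * M\<^sup>2 * real (2*N-3)) * (a\<^sup>2 * U) \<le> rate_const * (a\<^sup>2 * U)"
    by (intro mult_right_mono rate_const_bounds) (use U in auto)
  moreover have "b' * (force (j+1) x * r ^ (2*k-1))\<^sup>2 = b * (scaled (2*j+1) x)\<^sup>2"
  proof -
    have "scaled (2*j+1) x = force (j+1) x * r ^ (2*k-1)"
      using scaled_simps(2)[of "j+1" x] by (simp add: ks[simplified] r_def)
    moreover have "force (j+1) x = 0" if "\<not> j < N - 1" using last that by (simp add: k_def)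
    ultimately show ?thesis by (auto simp: b'_def)
  qed
  ultimately show ?thesis unfolding sc U_def[symmetric] by (simp add: mult.assoc)
qed

lemma lyapunov_rate_le:
  assumes a: "\<And>k. k \<le> 2*N-2 \<Longrightarrow> a k \<ge> 1"
    and dom: "\<And>k. k < 2*N-2 \<Longrightarrow> 4 * rate_const * (\<Sum>m=Suc k..2*N-2. (a m)\<^sup>2) \<le> a k"
  shows "lyapunov_rate a x \<le> - (\<Sum>k\<le>2*N-2. (scaled k x)\<^sup>2) / 4"
proof -
  define T where "T m = (if odd m then odd_rate (a m) ((m+1) div 2) x else even_rate (a m) (m div 2) x)" for m
  have "(\<Sum>k\<le>2*N-2. (scaled k x)\<^sup>2) / 4 \<le> a 0 * (scaled 0 x)\<^sup>2 + (\<Sum>m=1..2*N-2. T m)"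
  proof (rule hierarchical_sum_lower_bound[OF _ a dom])
    show "0 \<le> rate_const"
      using rate_const_bounds(1) M c by (auto simp: rate_const_def)
    have "Suc (2*N-2) = 2*N-1" using N by simp
    then show "scaled (Suc (2*N-2)) x = 0" using scaled_simps(2)[of N x] N by simp
    fix m assume m: "m \<in> {1..2*N-2}"
    show "a m * (scaled m x)\<^sup>2 - (a m * (scaled m x)\<^sup>2 + a (Suc m) * (scaled (Suc m) x)\<^sup>2) / 4
       - rate_const * (a m)\<^sup>2 * (\<Sum>k<m. (scaled k x)\<^sup>2) \<le> T m"
    proof (cases "odd m")
      case True
      then obtain i where i: "m = 2*i+1" by (elim oddE)
      \<comment> \<open>The top index \<open>2*N-2\<close> is even, so an odd \<open>m\<close>
        always has a successor in range; for even \<open>m\<close> this fails on the last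
        bond.\<close>
      have "Suc m \<le> 2*N-2" using m i by simp presburger
      then have "i + 1 \<in> {1..N-1}" "1 \<le> a m" "1 \<le> a (Suc m)" using i a by auto
      from odd_rate_lower_bound[OF this, of x] show ?thesis by (simp add: T_def i)
    next
      case False
      then obtain i where i: "m = 2*i" by (auto elim: evenE)
      have "i \<in> {1..N-1}" "1 \<le> a m" "i < N-1 \<Longrightarrow> 1 \<le> a (Suc m)" using m i a by auto
      from even_rate_lower_bound[OF this, of x] show ?thesis by (simp add: T_def i)
    qed
  qed
  also have "(\<Sum>m=1..2*N-2. T m) = (\<Sum>j=1..N-1. T (2*j-1) + T (2*j))"
    using sum_pairs[of T "N-1"] by (simp add: diff_mult_distrib2)
  also have "\<dots> = (\<Sum>j=1..N-1. odd_rate (a (2*j-1)) j x + even_rate (a (2*j)) j x)"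
    by (intro sum.cong refl) (auto simp: T_def)
  also have "a 0 * (scaled 0 x)\<^sup>2 \<le> a 0 * (real (gamma0 N) * energy x ^ (gamma0 N - 1) * (fst x 1)\<^sup>2)"
  proof (intro mult_left_mono)
    have g: "gamma0 N - 1 = 2*N-2" by (simp add: gamma0_def)
    have "(scaled 0 x)\<^sup>2 = 1 * ((energy x) ^ (2*N-2) * (fst x 1)\<^sup>2)"
      using sqrt_energy(2)[of x]
      by (metis mult.commute mult.right_neutral power_mult power_mult_distrib scaled_simps(1))
    also have "\<dots> \<le> real (gamma0 N) * ((energy x) ^ (2*N-2) * (fst x 1)\<^sup>2)"
      using N energy_ge_1[of x] by (intro mult_right_mono) (auto simp: gamma0_def)
    finally show "(scaled 0 x)\<^sup>2 \<le> real (gamma0 N) * energy x ^ (gamma0 N - 1) * (fst x 1)\<^sup>2"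
      unfolding g by (simp add: mult.assoc)
  qed (use a[of 0] in auto)
  finally show ?thesis by (simp add: lyapunov_rate_def)
qed

text \<open>The threshold makes the potential energy at most half of the total, so the energy is at
  most twice the kinetic part, which the scaled quantities control.\<close>

lemma energy_le_scaled:
  assumes "energy x \<ge> 2 * real N * M"
  shows "energy x \<le> N * momentum_const * (\<Sum>k\<le>2*N-2. (scaled k x)\<^sup>2)"
proof -
  let ?S = "\<Sum>k\<le>2*N-2. (scaled k x)\<^sup>2"
  have "(fst x j)\<^sup>2 \<le> momentum_const * ?S" if j: "j \<in> {1..N}" for j
  proof -
    have "1 \<le> sqrt (energy x) ^ (2*N-2*j)" using sqrt_energy by (intro one_le_power) auto
    then have "(fst x j)\<^sup>2 * 1 \<le> (fst x j)\<^sup>2 * (sqrt (energy x) ^ (2*N-2*j))\<^sup>2"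
      by (intro mult_left_mono one_le_power) (use energy_ge_1[of x] in auto)
    also have "\<dots> \<le> momentum_const * (\<Sum>k<2*j-1. (scaled k x)\<^sup>2)"
      using scaled_momentum_bound[OF j] by (simp add: power_mult_distrib)
    also have "\<dots> \<le> momentum_const * ?S"
      using j rate_const_bounds(1) by (intro mult_left_mono sum_mono2) auto
    finally show ?thesis by simp
  qed
  then have "(\<Sum>j=1..N. (fst x j)\<^sup>2 / 2) \<le> (\<Sum>j=1..N. momentum_const * ?S / 2)"
    by (intro sum_mono divide_right_mono) auto
  then have "energy x \<le> N * (momentum_const * ?S) / 2 + real (N-1) * M"
    using potential_bounds(2)[of x] unfolding energy_eq by simp
  moreover have "real (N-1) * M \<le> real N * M" using M by (intro mult_right_mono) auto
  ultimately show ?thesis using assms by (simp add: mult.assoc)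
qed

section \<open>Explicit form of the Lyapunov function and its distance from the leading
  power\<close>

text \<open>Only the two angles at the ends of bond \<open>j\<close> enter \<open>xi V j\<close>,
  with opposite partial derivatives, so the Lie derivative collapses to a multiple of the
  gap.\<close>

lemma lie_deriv_xi:
  assumes j: "j \<in> {1..N-1}"
  shows "lie_deriv N (rotator_field N V) (xi V j) x = force_rate j x"
proof -
  obtain p q where x: "x = (p, q)" by (cases x)
  define b where "b = deriv (deriv (V j)) (q j - q (j + 1))"
  have d: "deriv (\<lambda>s. xi V j (p, q(i := s))) (q i) = (if i = j then - b else 0) + (if i = j + 1 then b else 0)" for i
  proof -
    note chain = DERIV_minus[OF DERIV_chain2[OF DV(2)[OF j]]]
    consider "i = j" | "i = j + 1" | "i \<noteq> j" "i \<noteq> j + 1" by blast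
    then show ?thesis
    proof cases
      case 1
      have "((\<lambda>s. - deriv (V j) (s - q (j + 1))) has_real_derivative - (b * 1)) (at (q j))"
        unfolding b_def by (rule chain) (auto intro!: derivative_eq_intros)
      then show ?thesis using 1 by (simp add: xi_def DERIV_imp_deriv)
    next
      case 2
      have "((\<lambda>s. - deriv (V j) (q j - s)) has_real_derivative - (b * (-1))) (at (q (j + 1)))"
        unfolding b_def by (rule chain) (auto intro!: derivative_eq_intros)
      then show ?thesis using 2 by (simp add: xi_def DERIV_imp_deriv)
    qed (simp add: xi_def)
  qed
  have jN: "j \<in> {1..N}" "j + 1 \<in> {1..N}" using j by auto
  have "lie_deriv N (rotator_field N V) (xi V j) x
     = (\<Sum>i=1..N. ((if i = j then - b else 0) + (if i = j + 1 then b else 0)) * p i)"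
    by (simp add: lie_deriv_def x d rotator_field_def) (simp add: xi_def)
  also have "\<dots> = (\<Sum>i=1..N. if i = j then - b * p i else 0) + (\<Sum>i=1..N. if i = j + 1 then b * p i else 0)"
    unfolding sum.distrib[symmetric] by (intro sum.cong) auto
  also have "\<dots> = - b * p j + b * p (j + 1)" using jN by (simp del: sum.cl_ivl_Suc)
  also have "\<dots> = force_rate j x" by (simp add: force_rate_def b_def x gap_def angle_def algebra_simps)
  finally show ?thesis .
qed

lemma lyapunov_eq:
  "lyapunov N V a x = a 0 * energy x ^ gamma0 N - (\<Sum>j=1..N-1.
      a (2*j-1) * energy x ^ alpha N (2*j-1) * fst x j * force j x
    + a (2*j) * energy x ^ alpha N (2*j) * force j x * force_rate j x)"
  unfolding lyapunov_def
  by (intro arg_cong2[of _ _ _ _ "(-)"] sum.cong refl) (simp add: lie_deriv_xi force_eq_xi)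

lemma force_rate_bound:
  assumes "j \<in> {1..N-1}" shows "\<bar>force_rate j x\<bar> \<le> M * (4 * sqrt (energy x))"
  unfolding force_rate_def abs_mult abs_minus_cancel
  using bounds(3)[OF assms] gap_le[OF assms] M by (intro mult_mono) auto

text \<open>Every correction has an energy exponent of at most \<open>gamma0 N - 2\<close>, a
  bounded force, and one further factor, a momentum or a force rate, of the order of the root of the
  energy.\<close>

lemma lyapunov_close_to_energy:
  "\<bar>lyapunov N V a x - a 0 * energy x ^ gamma0 N\<bar>
     \<le> (\<Sum>j=1..N-1. \<bar>a (2*j-1)\<bar> * 2 * M + \<bar>a (2*j)\<bar> * 4 * M\<^sup>2) * (energy x ^ (gamma0 N - 2) * sqrt (energy x))"
proof -
  let ?E = "energy x ^ (gamma0 N - 2) * sqrt (energy x)"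
  have "\<bar>lyapunov N V a x - a 0 * energy x ^ gamma0 N\<bar> = \<bar>\<Sum>j=1..N-1.
      a (2*j-1) * energy x ^ alpha N (2*j-1) * fst x j * force j x
    + a (2*j) * energy x ^ alpha N (2*j) * force j x * force_rate j x\<bar>"
    unfolding lyapunov_eq by simp
  also have "\<dots> \<le> (\<Sum>j=1..N-1. \<bar>a (2*j-1) * energy x ^ alpha N (2*j-1) * fst x j * force j x
    + a (2*j) * energy x ^ alpha N (2*j) * force j x * force_rate j x\<bar>)"
    by (rule sum_abs)
  also have "\<dots> \<le> (\<Sum>j=1..N-1. \<bar>a (2*j-1)\<bar> * 2 * M * ?E + \<bar>a (2*j)\<bar> * 4 * M\<^sup>2 * ?E)"
  proof (intro sum_mono order_trans[OF abs_triangle_ineq] add_mono)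
    fix j assume j: "j \<in> {1..N-1}"
    have E: "energy x ^ alpha N k \<le> energy x ^ (gamma0 N - 2)" if "k \<ge> 1" for k
      using energy_ge_1[of x] that by (intro power_increasing) (auto simp: alpha_def gamma0_def)
    have jN: "j \<in> {1..N}" using j by auto
    have "\<bar>a (2*j-1) * energy x ^ alpha N (2*j-1) * fst x j * force j x\<bar>
        = \<bar>a (2*j-1)\<bar> * energy x ^ alpha N (2*j-1) * \<bar>fst x j\<bar> * \<bar>force j x\<bar>"
      using energy_ge_1[of x] by (simp add: abs_mult)
    also have "\<dots> \<le> \<bar>a (2*j-1)\<bar> * energy x ^ (gamma0 N - 2) * (2 * sqrt (energy x)) * M"
      using energy_ge_1[of x] j E[of "2*j-1"] momentum_bound[OF jN] M
      by (intro mult_mono force_bound) auto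
    finally show "\<bar>a (2*j-1) * energy x ^ alpha N (2*j-1) * fst x j * force j x\<bar> \<le> \<bar>a (2*j-1)\<bar> * 2 * M * ?E"
      by (simp add: mult_ac)
    have "\<bar>a (2*j) * energy x ^ alpha N (2*j) * force j x * force_rate j x\<bar>
        = \<bar>a (2*j)\<bar> * energy x ^ alpha N (2*j) * \<bar>force j x\<bar> * \<bar>force_rate j x\<bar>"
      using energy_ge_1[of x] by (simp add: abs_mult)
    also have "\<dots> \<le> \<bar>a (2*j)\<bar> * energy x ^ (gamma0 N - 2) * M * (M * (4 * sqrt (energy x)))"
      using energy_ge_1[of x] j E[of "2*j"] force_rate_bound[OF j] M
      by (intro mult_mono force_bound) auto
    finally show "\<bar>a (2*j) * energy x ^ alpha N (2*j) * force j x * force_rate j x\<bar> \<le> \<bar>a (2*j)\<bar> * 4 * M\<^sup>2 * ?E"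
      by (simp add: mult_ac power2_eq_square)
  qed
  finally show ?thesis by (simp add: sum_distrib_right distrib_right)
qed

section \<open>Time derivatives along a solution\<close>

context
  fixes z :: "real \<Rightarrow> state" and t :: real
  assumes z: "rotator_solution N V z" and t: "t \<ge> 0"
begin

lemma momentum_deriv:
  assumes "j \<in> {1..N}"
  shows "((\<lambda>s. fst (z s) j) has_real_derivative momentum_rate j (z t)) (at t within {0..})"
proof -
  have "momentum_rate j (z t) = fst (rotator_field N V (z t)) j"
    using assms by (cases "z t")
      (simp add: momentum_rate_def rotator_field_def force_def friction_def angle_def)
  then show ?thesis using z t assms by (simp add: rotator_solution_def)
qed

lemma angle_deriv:
  assumes "j \<in> {1..N-1}"
  shows "((\<lambda>s. angle j (z s)) has_real_derivative gap j (z t)) (at t within {0..})"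
proof -
  have "((\<lambda>s. snd (z s) i) has_real_derivative fst (z t) i) (at t within {0..})" if "i \<in> {1..N}" for i
  proof -
    have "snd (rotator_field N V (z t)) i = fst (z t) i"
      by (cases "z t") (simp add: rotator_field_def)
    moreover have "((\<lambda>s. snd (z s) i) has_real_derivative snd (rotator_field N V (z t)) i) (at t within {0..})"
      using z t that unfolding rotator_solution_def by blast
    ultimately show ?thesis by simp
  qed
  moreover have "j \<in> {1..N}" "j + 1 \<in> {1..N}" using assms by auto
  ultimately have "((\<lambda>s. snd (z s) j - snd (z s) (j + 1)) has_real_derivative fst (z t) j - fst (z t) (j + 1))
      (at t within {0..})"
    by (intro DERIV_diff)
  then show ?thesis
    using assms by (auto simp: angle_def gap_def)
qed

lemma force_deriv:
  assumes "j \<in> {1..N-1}"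
  shows "((\<lambda>s. force j (z s)) has_real_derivative force_rate j (z t)) (at t within {0..})"
  using DERIV_minus[OF DERIV_chain2[OF DV(2)[OF assms] angle_deriv[OF assms]]] assms
  by (simp add: force_def force_rate_def ext_pot_def)

lemma gap_deriv:
  assumes "j \<in> {1..N-1}"
  shows "((\<lambda>s. gap j (z s)) has_real_derivative momentum_rate j (z t) - momentum_rate (j+1) (z t))
    (at t within {0..})"
  unfolding gap_def by (intro DERIV_diff momentum_deriv) (use assms in auto)

lemma force_rate_deriv:
  assumes "j \<in> {1..N-1}"
  shows "((\<lambda>s. force_rate j (z s)) has_real_derivative force_rate2 j (z t)) (at t within {0..})"
  using DERIV_mult[OF DERIV_minus[OF DERIV_chain2[OF DV(3)[OF assms] angle_deriv[OF assms]]] gap_deriv[OF assms]]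
  by (simp add: force_rate_def force_rate2_def power2_eq_square algebra_simps)

text \<open>The power of the internal forces cancels against the change of potential energy after
  summation by parts along the chain; the friction on the first rotator is what remains.\<close>

lemma energy_deriv:
  "((\<lambda>s. energy (z s)) has_real_derivative - (fst (z t) 1)\<^sup>2) (at t within {0..})"
proof -
  have pot: "((\<lambda>s. V j (angle j (z s))) has_real_derivative - force j (z t) * gap j (z t)) (at t within {0..})"
    if "j \<in> {1..N-1}" for j
    using DERIV_chain2[OF DV(1)[OF that] angle_deriv[OF that]] that
    by (simp add: force_def ext_pot_def)
  have kin: "((\<lambda>s. (fst (z s) j)\<^sup>2 / 2) has_real_derivative fst (z t) j * momentum_rate j (z t)) (at t within {0..})"
    if "j \<in> {1..N}" for j
    by (auto intro!: derivative_eq_intros momentum_deriv that)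
  have "((\<lambda>s. energy (z s)) has_real_derivative
     (\<Sum>j=1..N. fst (z t) j * momentum_rate j (z t)) + (\<Sum>j=1..N-1. - force j (z t) * gap j (z t))) (at t within {0..})"
    unfolding energy_eq by (intro DERIV_add DERIV_sum kin pot)
  moreover have "(\<Sum>j=1..N. fst (z t) j * momentum_rate j (z t)) + (\<Sum>j=1..N-1. - force j (z t) * gap j (z t))
      = - (fst (z t) 1)\<^sup>2"
  proof -
    obtain n where n: "N = Suc n" using N by (cases N) auto
    define p where "p = fst (z t)"
    have "(\<Sum>j=1..N. p j * momentum_rate j (z t))
        = - (\<Sum>j=1..N. if j = 1 then (p j)\<^sup>2 else 0) - (\<Sum>j=1..N. p j * force (j-1) (z t)) + (\<Sum>j=1..N. p j * force j (z t))"
      unfolding sum_subtractf[symmetric] sum_negf[symmetric] sum.distrib[symmetric]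
      by (intro sum.cong) (auto simp: momentum_rate_def friction_def p_def power2_eq_square algebra_simps)
    also have "(\<Sum>j=1..N. if j = 1 then (p j)\<^sup>2 else 0) = (p 1)\<^sup>2" using N by simp
    \<comment> \<open>Summation by parts: the boundary terms vanish because bonds 0 and
      \<open>N\<close> carry no force.\<close>
    also have "(\<Sum>j=1..N. p j * force (j-1) (z t)) = (\<Sum>j=1..n. p (j+1) * force j (z t))"
    proof -
      have "(\<Sum>j=1..N. p j * force (j-1) (z t)) = (\<Sum>j=0..n. p (Suc j) * force j (z t))"
        unfolding n One_nat_def by (subst sum.shift_bounds_cl_Suc_ivl) simp
      then show ?thesis by (simp add: sum.atLeast_Suc_atMost)
    qed
    also have "(\<Sum>j=1..N. p j * force j (z t)) = (\<Sum>j=1..n. p j * force j (z t))"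
      using force_missing(2)[of "z t"] unfolding n by simp
    finally show ?thesis
      by (simp add: n p_def gap_def algebra_simps sum_subtractf sum_negf sum.distrib)
  qed
  ultimately show ?thesis by simp
qed

lemma lyapunov_deriv:
  "((\<lambda>s. lyapunov N V a (z s)) has_real_derivative lyapunov_rate a (z t)) (at t within {0..})"
proof -
  note E = DERIV_power[OF energy_deriv]
  have lead: "((\<lambda>s. a 0 * energy (z s) ^ gamma0 N) has_real_derivative
      - (a 0 * (real (gamma0 N) * energy (z t) ^ (gamma0 N - 1) * (fst (z t) 1)\<^sup>2))) (at t within {0..})"
    by (rule DERIV_cong[OF DERIV_cmult[OF E]]) (simp add: algebra_simps)
  have odd: "((\<lambda>s. a (2*j-1) * energy (z s) ^ alpha N (2*j-1) * fst (z s) j * force j (z s)) has_real_derivative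
      odd_rate (a (2*j-1)) j (z t)) (at t within {0..})" if j: "j \<in> {1..N-1}" for j
  proof -
    have "j \<in> {1..N}" using j by auto
    then show ?thesis
      by (rule DERIV_cong[OF DERIV_mult[OF DERIV_mult[OF DERIV_cmult[OF E] momentum_deriv] force_deriv[OF j]]])
        (simp add: odd_rate_def algebra_simps)
  qed
  have even: "((\<lambda>s. a (2*j) * energy (z s) ^ alpha N (2*j) * force j (z s) * force_rate j (z s)) has_real_derivative
      even_rate (a (2*j)) j (z t)) (at t within {0..})" if j: "j \<in> {1..N-1}" for j
    by (rule DERIV_cong[OF DERIV_mult[OF DERIV_mult[OF DERIV_cmult[OF E] force_deriv[OF j]] force_rate_deriv[OF j]]])
      (simp add: even_rate_def power2_eq_square algebra_simps)
  show ?thesis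
    unfolding lyapunov_eq lyapunov_rate_def minus_add_distrib diff_conv_add_uminus[symmetric]
    by (intro DERIV_diff lead DERIV_sum DERIV_add odd even)
qed

end

section \<open>Decay along solutions\<close>

lemma energy_antimono:
  assumes z: "rotator_solution N V z" and st: "0 \<le> s" "s \<le> t"
  shows "energy (z t) \<le> energy (z s)"
  using growth_le_of_deriv_le[OF energy_deriv[OF z], of s t 0] st by auto

lemma decay:
  assumes a: "\<And>k. k \<le> 2*N-2 \<Longrightarrow> a k \<ge> 1"
    and dom: "\<And>k. k < 2*N-2 \<Longrightarrow> 4 * rate_const * (\<Sum>m=Suc k..2*N-2. (a m)\<^sup>2) \<le> a k"
  shows "\<exists>h0 \<epsilon> C :: real. h0 \<ge> 1 \<and> 0 < \<epsilon> \<and> \<epsilon> < 1 \<and> C > 0 \<and>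
      (\<forall>z. rotator_solution N V z \<longrightarrow>
        (let W = (\<lambda>t. lyapunov N V a (z t));
             H = (\<lambda>t. hamiltonian N V (z t))
         in H 0 \<ge> h0 \<longrightarrow>
           (\<forall>t. 0 \<le> t \<and> t \<le> \<epsilon> * H 0 ^ (gamma0 N - 1) \<longrightarrow>
              W t \<le> W 0 - C * t * W 0 powr (1 / real (gamma0 N))) \<and>
           (\<forall>t. inverse \<epsilon> * H 0 powr (real (gamma0 N) - 5/2) \<le> t \<and> t \<le> \<epsilon> * H 0 ^ (gamma0 N - 1) \<longrightarrow>
              H t \<le> H 0 - C * t / H 0 ^ (gamma0 N - 2))))"
proof -
  define B0 where "B0 = (\<Sum>j=1..N-1. \<bar>a (2*j-1)\<bar> * 2 * M + \<bar>a (2*j)\<bar> * 4 * M\<^sup>2)"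
  \<comment> \<open>A quarter of the sum of squares is dissipated, and
    \<open>N * momentum_const\<close> times that sum bounds the energy.\<close>
  define c0 where "c0 = 1 / (4 * (N * momentum_const))"
  have mc: "N * momentum_const > 0" using N c by (simp add: momentum_const_def)
  have n3: "gamma0 N \<ge> 3" using N by (simp add: gamma0_def)
  have a0: "a 0 \<ge> 1" using a by simp
  have h1: "2 * real N * M \<ge> 1" using mult_mono[of 1 "2 * real N" 1 M] N M by simp
  have c0: "c0 > 0" using mc by (simp add: c0_def)
  have rate: "lyapunov_rate a x \<le> - (c0 * energy x)" if "energy x \<ge> 2 * real N * M" for x
  proof -
    have "c0 * energy x \<le> c0 * (N * momentum_const * (\<Sum>k\<le>2*N-2. (scaled k x)\<^sup>2))"
      using energy_le_scaled[OF that] c0 by (intro mult_left_mono) auto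
    also have "\<dots> = (\<Sum>k\<le>2*N-2. (scaled k x)\<^sup>2) / 4"
    proof -
      have "N \<noteq> 0" "momentum_const \<noteq> 0" using mc N by auto
      then have "c0 * (N * momentum_const) = 1 / 4" by (simp add: c0_def)
      then show ?thesis by (simp add: mult.assoc[symmetric])
    qed
    finally show ?thesis using lyapunov_rate_le[OF a dom, of x] by simp
  qed
  \<comment> \<open>The maximum with 1 meets the condition \<open>B \<ge> 1\<close> of
    \<open>decay_from_lyapunov_rate\<close>.\<close>
  have close: "\<bar>lyapunov N V a x - a 0 * energy x ^ gamma0 N\<bar>
      \<le> max 1 B0 * (energy x ^ (gamma0 N - 2) * sqrt (energy x))" for x
    using energy_ge_1[of x]
    by (intro order_trans[OF lyapunov_close_to_energy] mult_right_mono) (auto simp: B0_def)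
  obtain h0 \<epsilon> C where const: "h0 \<ge> 1" "0 < \<epsilon>" "\<epsilon> < 1" "C > 0"
    and decay: "\<And>H W W'. \<lbrakk>\<And>t. t \<ge> 0 \<Longrightarrow> H t \<ge> 1; \<And>s t. 0 \<le> s \<Longrightarrow> s \<le> t \<Longrightarrow> H t \<le> H s;
           \<And>t. t \<ge> 0 \<Longrightarrow> \<bar>W t - a 0 * H t ^ gamma0 N\<bar> \<le> max 1 B0 * (H t ^ (gamma0 N - 2) * sqrt (H t));
           \<And>t. t \<ge> 0 \<Longrightarrow> (W has_real_derivative W' t) (at t within {0..});
           \<And>t. t \<ge> 0 \<Longrightarrow> H t \<ge> 2 * real N * M \<Longrightarrow> W' t \<le> - c0 * H t; H 0 \<ge> h0\<rbrakk> \<Longrightarrow>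
         (\<forall>t. 0 \<le> t \<and> t \<le> \<epsilon> * H 0 ^ (gamma0 N - 1) \<longrightarrow> W t \<le> W 0 - C * t * W 0 powr (1 / real (gamma0 N))) \<and>
         (\<forall>t. inverse \<epsilon> * H 0 powr (real (gamma0 N) - 5/2) \<le> t \<and> t \<le> \<epsilon> * H 0 ^ (gamma0 N - 1) \<longrightarrow>
              H t \<le> H 0 - C * t / H 0 ^ (gamma0 N - 2))"
    by (rule decay_from_lyapunov_rate[OF n3 a0 max.cobounded1 c0 h1]) blast
  have "h0 \<le> energy (z 0) \<longrightarrow>
      (\<forall>t. 0 \<le> t \<and> t \<le> \<epsilon> * energy (z 0) ^ (gamma0 N - 1) \<longrightarrow>
         lyapunov N V a (z t) \<le> lyapunov N V a (z 0)
           - C * t * lyapunov N V a (z 0) powr (1 / real (gamma0 N))) \<and>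
      (\<forall>t. inverse \<epsilon> * energy (z 0) powr (real (gamma0 N) - 5/2) \<le> t
           \<and> t \<le> \<epsilon> * energy (z 0) ^ (gamma0 N - 1) \<longrightarrow>
         energy (z t) \<le> energy (z 0) - C * t / energy (z 0) ^ (gamma0 N - 2))"
    if z: "rotator_solution N V z" for z
    by (rule impI, rule decay[of "\<lambda>t. energy (z t)" "\<lambda>t. lyapunov N V a (z t)" "\<lambda>t. lyapunov_rate a (z t)"])
      (auto intro: energy_ge_1 energy_antimono[OF z] close lyapunov_deriv[OF z] rate)
  then show ?thesis unfolding Let_def using const by blast
qed

end

section \<open>Periodic potentials\<close>

lemma periodic_attained:
  fixes f :: "real \<Rightarrow> real"
  assumes L: "L > 0" and per: "\<And>x. f (x + L) = f x"
  obtains y where "y \<in> {0..L}" "f y = f x"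
proof
  have nat: "f (x + real n * L) = f x" for n x
  proof (induction n)
    case (Suc n)
    have "f (x + real (Suc n) * L) = f (x + real n * L + L)" by (simp add: algebra_simps)
    then show ?case using per Suc by simp
  qed simp
  have int: "f (x + of_int k * L) = f x" for k x
  proof (cases "k \<ge> 0")
    case True then show ?thesis using nat[of x "nat k"] by simp
  next
    case False
    then show ?thesis using nat[of "x + of_int k * L" "nat (- k)"] by (simp add: algebra_simps)
  qed
  show "f (x - of_int \<lfloor>x / L\<rfloor> * L) = f x" using int[of x "- \<lfloor>x / L\<rfloor>"] by simp
  show "x - of_int \<lfloor>x / L\<rfloor> * L \<in> {0..L}"
    using floor_divide_lower[OF L, of x] floor_divide_upper[OF L, of x] by (simp add: distrib_right)
qed

lemma periodic_attains_inf:
  fixes f :: "real \<Rightarrow> real"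
  assumes L: "L > 0" and per: "\<And>x. f (x + L) = f x" and cont: "continuous_on UNIV f"
  obtains y where "\<And>x. f y \<le> f x"
proof -
  have "continuous_on {0..L} f" using cont continuous_on_subset by blast
  then have "\<exists>y\<in>{0..L}. \<forall>x\<in>{0..L}. f y \<le> f x"
    using L by (intro continuous_attains_inf) auto
  then obtain y where y: "\<And>x. x \<in> {0..L} \<Longrightarrow> f y \<le> f x" by blast
  have "f y \<le> f x" for x
    using periodic_attained[of L f x, OF L per] y by metis
  then show thesis by (rule that)
qed

text \<open>A minimum of the negated absolute value is a maximum of the absolute value.\<close>

lemma periodic_bounded:
  fixes f :: "real \<Rightarrow> real"
  assumes L: "L > 0" and per: "\<And>x. f (x + L) = f x" and cont: "continuous_on UNIV f"
  obtains B where "\<And>x. \<bar>f x\<bar> \<le> B"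
proof -
  have "continuous_on UNIV (\<lambda>x. - \<bar>f x\<bar>)" using cont by (intro continuous_intros)
  then obtain y where "\<And>x. - \<bar>f y\<bar> \<le> - \<bar>f x\<bar>"
    using periodic_attains_inf[OF L, of "\<lambda>x. - \<bar>f x\<bar>"] per by metis
  then show thesis by (intro that[of "\<bar>f y\<bar>"]) simp
qed

text \<open>The relation that defines \<open>deriv\<close> is itself invariant under a shift by
  \<open>L\<close>, so equality holds whether or not the derivative exists.\<close>

lemma deriv_periodic:
  fixes f :: "real \<Rightarrow> real"
  assumes "\<And>x. f (x + L) = f x"
  shows "deriv f (x + L) = deriv f x"
  using DERIV_shift[of f _ x L] assms by (simp add: deriv_def)

text \<open>Unfolds the iterated derivatives in \<open>Ck_smooth\<close> into the form of the
  locale. All derivatives inherit the period, so continuity bounds them; for the third one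
  continuity is part of the smoothness assumption.\<close>

lemma circle_C3_chain:
  assumes "L > 0" "circle_Ck L 3 f"
  shows "(f has_real_derivative deriv f x) (at x)"
    "(deriv f has_real_derivative deriv (deriv f) x) (at x)"
    "(deriv (deriv f) has_real_derivative deriv (deriv (deriv f)) x) (at x)"
    "\<exists>B. \<forall>x. \<bar>f x\<bar> \<le> B \<and> \<bar>deriv f x\<bar> \<le> B \<and> \<bar>deriv (deriv f) x\<bar> \<le> B \<and> \<bar>deriv (deriv (deriv f)) x\<bar> \<le> B"
    "continuous_on UNIV (deriv f)" "continuous_on UNIV (deriv (deriv f))"
proof -
  have per: "f (x + L) = f x" for x using assms by (simp add: circle_Ck_def)
  have d: "(deriv ^^ i) f differentiable_on UNIV" if "i < 3" for i
    using assms that by (simp add: circle_Ck_def Ck_smooth_def)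
  have D: "f differentiable_on UNIV" "deriv f differentiable_on UNIV" "deriv (deriv f) differentiable_on UNIV"
    using d[of 0] d[of 1] d[of 2] by (simp_all add: numeral_2_eq_2)
  have C: "continuous_on UNIV (deriv (deriv (deriv f)))"
    using assms by (simp add: circle_Ck_def Ck_smooth_def numeral_3_eq_3)
  have *: "(g has_real_derivative deriv g x) (at x)" if "g differentiable_on UNIV" for g x
    using that by (metis DERIV_deriv_iff_real_differentiable UNIV_I differentiable_on_def)
  show "(f has_real_derivative deriv f x) (at x)"
    "(deriv f has_real_derivative deriv (deriv f) x) (at x)"
    "(deriv (deriv f) has_real_derivative deriv (deriv (deriv f)) x) (at x)"
    using D by (auto intro: *)
  show cd: "continuous_on UNIV (deriv f)" "continuous_on UNIV (deriv (deriv f))"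
    using D by (auto intro: differentiable_imp_continuous_on)
  note p1 = deriv_periodic[of f L, OF per]
  note p2 = deriv_periodic[of "deriv f" L, OF p1]
  note p3 = deriv_periodic[of "deriv (deriv f)" L, OF p2]
  obtain B0 where B0: "\<And>x. \<bar>f x\<bar> \<le> B0"
    using periodic_bounded[OF assms(1) per differentiable_imp_continuous_on[OF D(1)]] by blast
  obtain B1 where B1: "\<And>x. \<bar>deriv f x\<bar> \<le> B1" using periodic_bounded[OF assms(1) p1 cd(1)] by blast
  obtain B2 where B2: "\<And>x. \<bar>deriv (deriv f) x\<bar> \<le> B2" using periodic_bounded[OF assms(1) p2 cd(2)] by blast
  obtain B3 where B3: "\<And>x. \<bar>deriv (deriv (deriv f)) x\<bar> \<le> B3" using periodic_bounded[OF assms(1) p3 C] by blast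
  show "\<exists>B. \<forall>x. \<bar>f x\<bar> \<le> B \<and> \<bar>deriv f x\<bar> \<le> B \<and> \<bar>deriv (deriv f) x\<bar> \<le> B \<and> \<bar>deriv (deriv (deriv f)) x\<bar> \<le> B"
    using B0 B1 B2 B3
    by (intro exI[of _ "max (max B0 B1) (max B2 B3)"]) (auto simp: le_max_iff_disj)
qed

theorem corollary3p2:
  fixes N :: nat and L :: real and V :: "nat \<Rightarrow> real \<Rightarrow> real"
  assumes "N \<ge> 2" and "L > 0"
    and "\<And>i. i \<in> {1..N-1} \<Longrightarrow> circle_Ck L 3 (V i)"
    and "\<And>i x. i \<in> {1..N-1} \<Longrightarrow> (deriv (V i) x)\<^sup>2 + (deriv (deriv (V i)) x)\<^sup>2 \<noteq> 0"
    and "\<And>i x. i \<in> {1..N-1} \<Longrightarrow> V i x \<ge> 1"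
  shows "\<exists>A :: nat \<Rightarrow> real list \<Rightarrow> real. \<forall>a :: nat \<Rightarrow> real.
    (\<forall>k\<le>2*N - 2. a k \<ge> 1) \<longrightarrow> sufficiently_large N A a \<longrightarrow>
    (\<exists>h0 \<epsilon> C :: real. h0 \<ge> 1 \<and> 0 < \<epsilon> \<and> \<epsilon> < 1 \<and> C > 0 \<and>
      (\<forall>z. rotator_solution N V z \<longrightarrow>
        (let W = (\<lambda>t. lyapunov N V a (z t));
             H = (\<lambda>t. hamiltonian N V (z t))
         in H 0 \<ge> h0 \<longrightarrow>
           (\<forall>t. 0 \<le> t \<and> t \<le> \<epsilon> * H 0 ^ (gamma0 N - 1) \<longrightarrow>
              W t \<le> W 0 - C * t * W 0 powr (1 / real (gamma0 N))) \<and>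
           (\<forall>t. inverse \<epsilon> * H 0 powr (real (gamma0 N) - 5/2) \<le> t \<and> t \<le> \<epsilon> * H 0 ^ (gamma0 N - 1) \<longrightarrow>
              H t \<le> H 0 - C * t / H 0 ^ (gamma0 N - 2)))))"
proof -
  let ?I = "{1..N-1}"
  note C3 = circle_C3_chain[OF \<open>L > 0\<close> assms(3)]
  obtain B where B: "\<And>i x. i \<in> ?I \<Longrightarrow> \<bar>V i x\<bar> \<le> B i \<and> \<bar>deriv (V i) x\<bar> \<le> B i
      \<and> \<bar>deriv (deriv (V i)) x\<bar> \<le> B i \<and> \<bar>deriv (deriv (deriv (V i))) x\<bar> \<le> B i"
    using C3(4) by metis
  define M where "M = Max (insert 1 (B ` ?I))"
  have M: "M \<ge> 1" "\<And>i. i \<in> ?I \<Longrightarrow> B i \<le> M"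
    unfolding M_def by (auto intro!: Max_ge simp del: Max_insert)
  define f where "f i x = (deriv (V i) x)\<^sup>2 + (deriv (deriv (V i)) x)\<^sup>2" for i x
  \<comment> \<open>The pointwise nondegeneracy becomes a uniform positive bound because the minimum
    over a period is attained.\<close>
  have "\<exists>y. \<forall>x. f i y \<le> f i x" if i: "i \<in> ?I" for i
  proof -
    have per: "V i (x + L) = V i x" for x using assms(3)[OF i] by (simp add: circle_Ck_def)
    note p1 = deriv_periodic[of "V i" L, OF per]
    note p2 = deriv_periodic[of "deriv (V i)" L, OF p1]
    have "continuous_on UNIV (f i)" unfolding f_def
      by (intro continuous_intros C3(5)[OF i] C3(6)[OF i])
    moreover have "f i (x + L) = f i x" for x by (simp add: f_def p1 p2)
    ultimately show ?thesis using periodic_attains_inf[OF \<open>L > 0\<close>, of "f i"] by metis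
  qed
  then obtain y where y: "\<And>i x. i \<in> ?I \<Longrightarrow> f i (y i) \<le> f i x" by metis
  \<comment> \<open>Inserting 1 gives \<open>c \<le> 1\<close>, as it gave \<open>M \<ge> 1\<close>
    above, and leaves the set nonempty.\<close>
  define c where "c = Min (insert 1 ((\<lambda>i. f i (y i)) ` ?I))"
  have fpos: "f i x > 0" if "i \<in> ?I" for i x
    using assms(4)[OF that, of x] by (simp add: f_def sum_power2_gt_zero_iff)
  have c: "0 < c" "c \<le> 1" "\<And>i. i \<in> ?I \<Longrightarrow> c \<le> f i (y i)"
    using fpos unfolding c_def by (auto simp: Min_gr_iff intro!: Min_le simp del: Min_insert)
  interpret rotator_chain N V M c
  proof
    fix i u assume i: "i \<in> ?I"
    show "V i u \<le> M" "\<bar>deriv (V i) u\<bar> \<le> M" "\<bar>deriv (deriv (V i)) u\<bar> \<le> M"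
      "\<bar>deriv (deriv (deriv (V i))) u\<bar> \<le> M"
      using B[OF i, of u] M(2)[OF i] by auto
    show "c \<le> (deriv (V i) u)\<^sup>2 + (deriv (deriv (V i)) u)\<^sup>2"
      using c(3)[OF i] y[OF i, of u] by (simp add: f_def)
  qed (use assms M c C3 in auto)
  \<comment> \<open>The threshold is the domination condition of \<open>decay\<close>, read off the
    list of later coefficients; \<open>rate_const\<close> depends only on \<open>N\<close> and the
    potentials, through \<open>M\<close> and \<open>c\<close>. The empty list gives threshold 0. A
    bound on \<open>a k - a (k+1)\<close> suffices since \<open>a (k+1)\<close> is positive.\<close>
  define A :: "nat \<Rightarrow> real list \<Rightarrow> real" where "A k l = 4 * rate_const * (\<Sum>x\<leftarrow>l. x\<^sup>2)" for k l
  show ?thesis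
  proof (intro exI[of _ A] allI impI decay)
    fix a k assume a: "\<forall>k\<le>2*N-2. a k \<ge> 1" and large: "sufficiently_large N A a"
    show "k \<le> 2*N-2 \<Longrightarrow> 1 \<le> a k" using a by simp
    assume k: "k < 2*N-2"
    have "A k (map a [k+1..<2*N-1]) \<le> a k - a (k+1)"
      using large k by (simp add: sufficiently_large_def)
    moreover have "1 \<le> a (k+1)" using a k by simp
    moreover have "A k (map a [k+1..<2*N-1]) = 4 * rate_const * (\<Sum>m=Suc k..2*N-2. (a m)\<^sup>2)"
    proof -
      have "{k+1..<2*N-1} = {Suc k..2*N-2}" using \<open>N \<ge> 2\<close> by auto
      then show ?thesis by (simp add: A_def comp_def sum_list_distinct_conv_sum_set)
    qed
    ultimately show "4 * rate_const * (\<Sum>m=Suc k..2*N-2. (a m)\<^sup>2) \<le> a k" by simp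
  qed
qed

end
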